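(* The systems $\mathcal{R}_{12}^r=\{\overline{\mathrm{Ref}},\mathrm{Rep}_1^{r},\mathrm{Rep}_2^{r}\}$ and $\mathcal{R}_2^{rl+}=\{\overline{\mathrm{Ref}},\mathrm{Rep}_2^{l+},\mathrm{Rep}_2^{r}\}$ are equivalent; hence the structural rules are admissible in $\mathbf{G3[mic]}^{\mathcal{R}_2^{rl+}}$ (in each of the minimal, intuitionistic and classical cases). The same holds for $\mathcal{R}_1^{rl+}=\{\overline{\mathrm{Ref}},\mathrm{Rep}_1^{l+},\mathrm{Rep}_1^{r}\}$ in place of $\mathcal{R}_2^{rl+}$.
   Context: Formulas are those of a first-order language with equality (constants and function symbols allowed), with bound variables syntactically distinct from free ones; equalities $t=t'$ are atomic; $\bot$ is not counted as atomic. A sequent $\Gamma\Rightarrow\Delta$ consists of finite multisets $\Gamma,\Delta$ of formulas; comma is multiset union. $F[x/r]$ is the result of replacing all free occurrences of $x$ in $F$ by the term $r$. Logical calculi. $\mathbf{G3c}$ has initial sequents $P,\Gamma\Rightarrow\Delta,P$ ($P$ atomic) and the rules: $L\wedge$: from $A,B,\Gamma\Rightarrow\Delta$ infer $A\wedge B,\Gamma\Rightarrow\Delta$. $R\wedge$: from $\Gamma\Rightarrow\Delta,A$ and $\Gamma\Rightarrow\Delta,B$ infer $\Gamma\Rightarrow\Delta,A\wedge B$. $L\vee$: from $A,\Gamma\Rightarrow\Delta$ and $B,\Gamma\Rightarrow\Delta$ infer $A\vee B,\Gamma\Rightarrow\Delta$. $R\vee$: from $\Gamma\Rightarrow\Delta,A,B$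 infer $\Gamma\Rightarrow\Delta,A\vee B$. $L\to$: from $\Gamma\Rightarrow\Delta,A$ and $B,\Gamma\Rightarrow\Delta$ infer $A\to B,\Gamma\Rightarrow\Delta$. $R\to$: from $A,\Gamma\Rightarrow\Delta,B$ infer $\Gamma\Rightarrow\Delta,A\to B$. $L\bot$: infer $\bot,\Gamma\Rightarrow\Delta$ (no premiss). $L\forall$: from $A[x/t],\forall xA,\Gamma\Rightarrow\Delta$ infer $\forall xA,\Gamma\Rightarrow\Delta$. $R\forall$: from $\Gamma\Rightarrow\Delta,A[x/a]$ infer $\Gamma\Rightarrow\Delta,\forall xA$. $L\exists$: from $A[x/a],\Gamma\Rightarrow\Delta$ infer $\exists xA,\Gamma\Rightarrow\Delta$. $R\exists$: from $\Gamma\Rightarrow\Delta,\exists xA,A[x/t]$ infer $\Gamma\Rightarrow\Delta,\exists xA$. In $L\exists$ and the $R\forall$ rules, $a$ is a free variable not occurring in the conclusion. $\mathbf{G3i}$ is $\mathbf{G3c}$ with $L\to,R\to,R\forall$ replaced by: $L^i\to$: from $A\to B,\Gamma\Rightarrow\Delta,A$ and $B,\Gamma\Rightarrow\Delta$ infer $A\to B,\Gamma\Rightarrow\Delta$; $R^i\to$: from $A,\Gamma\Rightarrow B$ infer $\Gamma\Rightarrow\Delta,A\to B$; $R^i\forall$: from $\Gamma\Rightarrow A[x/a]$ infer $\Gamma\Rightarrow\Delta,\forall xA$. $\mathbf{G3m}$ is $\mathbf{G3i}$ with $L\bot$ replaced by the initial sequents $\bot,\Gamma\Rightarrow\Delta,\bot$.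 $\mathbf{G3[mic]}$ denotes any of the three; $\mathbf{G3[mic]}^{\mathcal R}$ is it together with the rules in $\mathcal R$. A set $\mathcal R$ of rules is identified with the calculus whose initial sequents are $P,\Gamma\Rightarrow\Delta,P$ ($P$ atomic) together with $\bot,\Gamma\Rightarrow\Delta$ in the intuitionistic and classical case, respectively $\bot,\Gamma\Rightarrow\Delta,\bot$ in the minimal case, and whose rules are those of $\mathcal R$ (no logical rules); statements about $\mathcal R$ are meant for each of these cases. Two calculi are equivalent if they derive the same sequents. Structural rules: weakening (from $\Gamma\Rightarrow\Delta$ infer $A,\Gamma\Rightarrow\Delta$; from $\Gamma\Rightarrow\Delta$ infer $\Gamma\Rightarrow\Delta,A$), contraction (from $A,A,\Gamma\Rightarrow\Delta$ infer $A,\Gamma\Rightarrow\Delta$; from $\Gamma\Rightarrow\Delta,A,A$ infer $\Gamma\Rightarrow\Delta,A$), and Cut (from $\Gamma\Rightarrow\Delta,A$ and $A,\Lambda\Rightarrow\Theta$ infer $\Gamma,\Lambda\Rightarrow\Delta,\Theta$), for arbitrary formulas $A$. A rule is admissible in a calculus if its conclusion is derivable whenever its premisses are. Equality rules ($P$ atomic, possibly an equality). $\overline{\mathrm{Ref}}$: axioms $\Gamma\Rightarrow\Delta,t=t$. $\mathrm{Rep}_1^{r}$: from $r=s,\Gamma\Rightarrow\Delta,P[x/r]$ infer $r=s,\Gamma\Rightarrow\Delta,P[x/s]$. $\mathrm{Rep}_2^{r}$: from $s=r,\Gamma\Rightarrow\Delta,P[x/r]$ infer $s=r,\Gamma\Rightarrow\Delta,P[x/s]$.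 $\mathrm{Rep}_1^{l}$: from $r=s,P[x/r],\Gamma\Rightarrow\Delta$ infer $r=s,P[x/s],\Gamma\Rightarrow\Delta$. $\mathrm{Rep}_2^{l}$: from $s=r,P[x/r],\Gamma\Rightarrow\Delta$ infer $s=r,P[x/s],\Gamma\Rightarrow\Delta$. $\mathrm{Rep}_1^{l+}$: the rule $\mathrm{Rep}_1^{l}$ with its instances in which $P$ is an equality $E$ replaced by: from $r=s,E[x/s],E[x/r],\Gamma\Rightarrow\Delta$ infer $r=s,E[x/s],\Gamma\Rightarrow\Delta$. $\mathrm{Rep}_2^{l+}$: the rule $\mathrm{Rep}_2^{l}$ with its instances in which $P$ is an equality $E$ replaced by: from $s=r,E[x/s],E[x/r],\Gamma\Rightarrow\Delta$ infer $s=r,E[x/s],\Gamma\Rightarrow\Delta$. *)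

theory Defs
  imports "HOL-Library.Multiset"
begin

section \<open>First-order languages with equality\<close>

text \<open>
  A language is given by its function symbols (constants being those of arity 0) and its
  predicate symbols other than equality, each symbol being a name together with an arity.
\<close>

datatype ('f, 'p) language =
  Language (funs: "('f \<times> nat) set") (preds: "('p \<times> nat) set")

text \<open>
  Free and bound variables are two disjoint syntactic sorts.  Raw terms and formulas may contain
  bound variables that are not in the scope of a quantifier, as does the body \<open>A\<close> of \<open>\<forall>xA\<close>.
  The terms and formulas of a language, in which this does not happen, are singled out
  by \<open>is_term\<close> and \<open>is_formula\<close>.
\<close>

datatype 'f tm = FV nat | BV nat | Fn 'f "'f tm list"

datatype ('f, 'p) fm =
    Bot
  | Pre 'p "'f tm list"
  | Eq "'f tm" "'f tm"
  | And "('f, 'p) fm" "('f, 'p) fm"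
  | Or "('f, 'p) fm" "('f, 'p) fm"
  | Imp "('f, 'p) fm" "('f, 'p) fm"
  | All nat "('f, 'p) fm"
  | Ex nat "('f, 'p) fm"

text \<open>The argument \<open>X\<close> is the set of bound variables whose quantifier has been passed.\<close>

fun wf_tm :: "('f, 'p) language \<Rightarrow> nat set \<Rightarrow> 'f tm \<Rightarrow> bool" where
  "wf_tm L X (FV a) \<longleftrightarrow> True"
| "wf_tm L X (BV x) \<longleftrightarrow> x \<in> X"
| "wf_tm L X (Fn f ts) \<longleftrightarrow> (f, length ts) \<in> funs L \<and> (\<forall>t \<in> set ts. wf_tm L X t)"

primrec wf_fm :: "('f, 'p) language \<Rightarrow> nat set \<Rightarrow> ('f, 'p) fm \<Rightarrow> bool" where
  "wf_fm L X Bot \<longleftrightarrow> True"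
| "wf_fm L X (Pre p ts) \<longleftrightarrow> (p, length ts) \<in> preds L \<and> (\<forall>t \<in> set ts. wf_tm L X t)"
| "wf_fm L X (Eq t u) \<longleftrightarrow> wf_tm L X t \<and> wf_tm L X u"
| "wf_fm L X (And A B) \<longleftrightarrow> wf_fm L X A \<and> wf_fm L X B"
| "wf_fm L X (Or A B) \<longleftrightarrow> wf_fm L X A \<and> wf_fm L X B"
| "wf_fm L X (Imp A B) \<longleftrightarrow> wf_fm L X A \<and> wf_fm L X B"
| "wf_fm L X (All x A) \<longleftrightarrow> wf_fm L (insert x X) A"
| "wf_fm L X (Ex x A) \<longleftrightarrow> wf_fm L (insert x X) A"

definition is_term :: "('f, 'p) language \<Rightarrow> 'f tm \<Rightarrow> bool" where
  "is_term L t \<longleftrightarrow> wf_tm L {} t"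

definition is_formula :: "('f, 'p) language \<Rightarrow> ('f, 'p) fm \<Rightarrow> bool" where
  "is_formula L A \<longleftrightarrow> wf_fm L {} A"

fun fvs_tm :: "'f tm \<Rightarrow> nat set" where
  "fvs_tm (FV a) = {a}"
| "fvs_tm (BV x) = {}"
| "fvs_tm (Fn f ts) = (\<Union>t \<in> set ts. fvs_tm t)"

primrec fvs_fm :: "('f, 'p) fm \<Rightarrow> nat set" where
  "fvs_fm Bot = {}"
| "fvs_fm (Pre p ts) = (\<Union>t \<in> set ts. fvs_tm t)"
| "fvs_fm (Eq t u) = fvs_tm t \<union> fvs_tm u"
| "fvs_fm (And A B) = fvs_fm A \<union> fvs_fm B"
| "fvs_fm (Or A B) = fvs_fm A \<union> fvs_fm B"
| "fvs_fm (Imp A B) = fvs_fm A \<union> fvs_fm B"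
| "fvs_fm (All x A) = fvs_fm A"
| "fvs_fm (Ex x A) = fvs_fm A"

text \<open>
  \<open>A\<langle>x/r\<rangle>\<close> replaces the occurrences of the bound variable \<open>x\<close> that are not bound in \<open>A\<close>.
  There is no renaming: \<open>r\<close> is always a term of the language, hence without bound variables,
  so nothing can be captured.
\<close>

primrec subst_tm :: "'f tm \<Rightarrow> nat \<Rightarrow> 'f tm \<Rightarrow> 'f tm" where
  "subst_tm (FV a) x r = FV a"
| "subst_tm (BV y) x r = (if y = x then r else BV y)"
| "subst_tm (Fn f ts) x r = Fn f (map (\<lambda>t. subst_tm t x r) ts)"

primrec subst :: "('f, 'p) fm \<Rightarrow> nat \<Rightarrow> 'f tm \<Rightarrow> ('f, 'p) fm" ("_\<langle>_'/_\<rangle>" [1000, 1000, 0] 1000) where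
  "subst Bot x r = Bot"
| "subst (Pre p ts) x r = Pre p (map (\<lambda>t. subst_tm t x r) ts)"
| "subst (Eq t u) x r = Eq (subst_tm t x r) (subst_tm u x r)"
| "subst (And A B) x r = And (subst A x r) (subst B x r)"
| "subst (Or A B) x r = Or (subst A x r) (subst B x r)"
| "subst (Imp A B) x r = Imp (subst A x r) (subst B x r)"
| "subst (All y A) x r = All y (if y = x then A else subst A x r)"
| "subst (Ex y A) x r = Ex y (if y = x then A else subst A x r)"

definition is_equality :: "('f, 'p) fm \<Rightarrow> bool" where
  "is_equality A \<longleftrightarrow> (\<exists>t u. A = Eq t u)"

definition atomic :: "('f, 'p) fm \<Rightarrow> bool" where
  "atomic A \<longleftrightarrow> (\<exists>p ts. A = Pre p ts) \<or> is_equality A"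


section \<open>Sequents, rules and calculi\<close>

type_synonym ('f, 'p) sequent = "('f, 'p) fm multiset \<times> ('f, 'p) fm multiset"

definition is_sequent :: "('f, 'p) language \<Rightarrow> ('f, 'p) sequent \<Rightarrow> bool" where
  "is_sequent L S \<longleftrightarrow> (\<forall>A \<in># fst S + snd S. is_formula L A)"

definition fvs_sequent :: "('f, 'p) sequent \<Rightarrow> nat set" where
  "fvs_sequent S = (\<Union>A \<in> set_mset (fst S + snd S). fvs_fm A)"

text \<open>
  A rule is the set of its instances (premisses, conclusion).  A calculus is the union of its rules,
  initial sequents being rules without premisses.  Rules are formulated for raw sequents; in
  derivations and for admissibility only instances consisting of sequents of the language count.
\<close>

type_synonym ('f, 'p) rule = "(('f, 'p) sequent list \<times> ('f, 'p) sequent) set"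

inductive derivable :: "('f, 'p) language \<Rightarrow> ('f, 'p) rule \<Rightarrow> ('f, 'p) sequent \<Rightarrow> bool"
  for L :: "('f, 'p) language" and C :: "('f, 'p) rule"
where
  derivableI: "(Ss, S) \<in> C \<Longrightarrow> is_sequent L S \<Longrightarrow> (\<And>S'. S' \<in> set Ss \<Longrightarrow> derivable L C S')
    \<Longrightarrow> derivable L C S"

definition admissible :: "('f, 'p) language \<Rightarrow> ('f, 'p) rule \<Rightarrow> ('f, 'p) rule \<Rightarrow> bool" where
  "admissible L C R \<longleftrightarrow>
    (\<forall>(Ss, S) \<in> R. is_sequent L S \<longrightarrow> (\<forall>S' \<in> set Ss. derivable L C S') \<longrightarrow> derivable L C S)"

definition equivalent :: "('f, 'p) language \<Rightarrow> ('f, 'p) rule \<Rightarrow> ('f, 'p) rule \<Rightarrow> bool" where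
  "equivalent L C D \<longleftrightarrow> (\<forall>S. derivable L C S \<longleftrightarrow> derivable L D S)"


section \<open>The logical calculi\<close>

datatype logic = Minimal | Intuitionistic | Classical

definition initial :: "('f, 'p) rule" where
  "initial = {([], (add_mset P \<Gamma>, add_mset P \<Delta>)) | P \<Gamma> \<Delta>. atomic P}"

definition L_bot :: "('f, 'p) rule" where
  "L_bot = {([], (add_mset Bot \<Gamma>, \<Delta>)) | \<Gamma> \<Delta>. True}"

definition initial_bot :: "('f, 'p) rule" where
  "initial_bot = {([], (add_mset Bot \<Gamma>, add_mset Bot \<Delta>)) | \<Gamma> \<Delta>. True}"

definition L_and :: "('f, 'p) rule" where
  "L_and = {([(add_mset A (add_mset B \<Gamma>), \<Delta>)],
      (add_mset (And A B) \<Gamma>, \<Delta>)) | A B \<Gamma> \<Delta>. True}"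

definition R_and :: "('f, 'p) rule" where
  "R_and = {([(\<Gamma>, add_mset A \<Delta>), (\<Gamma>, add_mset B \<Delta>)],
      (\<Gamma>, add_mset (And A B) \<Delta>)) | A B \<Gamma> \<Delta>. True}"

definition L_or :: "('f, 'p) rule" where
  "L_or = {([(add_mset A \<Gamma>, \<Delta>), (add_mset B \<Gamma>, \<Delta>)],
      (add_mset (Or A B) \<Gamma>, \<Delta>)) | A B \<Gamma> \<Delta>. True}"

definition R_or :: "('f, 'p) rule" where
  "R_or = {([(\<Gamma>, add_mset A (add_mset B \<Delta>))],
      (\<Gamma>, add_mset (Or A B) \<Delta>)) | A B \<Gamma> \<Delta>. True}"

definition L_imp :: "('f, 'p) rule" where
  "L_imp = {([(\<Gamma>, add_mset A \<Delta>), (add_mset B \<Gamma>, \<Delta>)],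
      (add_mset (Imp A B) \<Gamma>, \<Delta>)) | A B \<Gamma> \<Delta>. True}"

definition R_imp :: "('f, 'p) rule" where
  "R_imp = {([(add_mset A \<Gamma>, add_mset B \<Delta>)],
      (\<Gamma>, add_mset (Imp A B) \<Delta>)) | A B \<Gamma> \<Delta>. True}"

definition L_all :: "('f, 'p) language \<Rightarrow> ('f, 'p) rule" where
  "L_all L = {([(add_mset (A\<langle>x/t\<rangle>) (add_mset (All x A) \<Gamma>), \<Delta>)],
      (add_mset (All x A) \<Gamma>, \<Delta>)) | A x t \<Gamma> \<Delta>. is_term L t}"

definition R_all :: "('f, 'p) rule" where
  "R_all = {([(\<Gamma>, add_mset (A\<langle>x/FV a\<rangle>) \<Delta>)],
      (\<Gamma>, add_mset (All x A) \<Delta>)) | A x a \<Gamma> \<Delta>.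
        a \<notin> fvs_sequent (\<Gamma>, add_mset (All x A) \<Delta>)}"

definition L_ex :: "('f, 'p) rule" where
  "L_ex = {([(add_mset (A\<langle>x/FV a\<rangle>) \<Gamma>, \<Delta>)],
      (add_mset (Ex x A) \<Gamma>, \<Delta>)) | A x a \<Gamma> \<Delta>.
        a \<notin> fvs_sequent (add_mset (Ex x A) \<Gamma>, \<Delta>)}"

definition R_ex :: "('f, 'p) language \<Rightarrow> ('f, 'p) rule" where
  "R_ex L = {([(\<Gamma>, add_mset (Ex x A) (add_mset (A\<langle>x/t\<rangle>) \<Delta>))],
      (\<Gamma>, add_mset (Ex x A) \<Delta>)) | A x t \<Gamma> \<Delta>. is_term L t}"

definition Li_imp :: "('f, 'p) rule" where
  "Li_imp = {([(add_mset (Imp A B) \<Gamma>, add_mset A \<Delta>), (add_mset B \<Gamma>, \<Delta>)],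
      (add_mset (Imp A B) \<Gamma>, \<Delta>)) | A B \<Gamma> \<Delta>. True}"

definition Ri_imp :: "('f, 'p) rule" where
  "Ri_imp = {([(add_mset A \<Gamma>, {#B#})],
      (\<Gamma>, add_mset (Imp A B) \<Delta>)) | A B \<Gamma> \<Delta>. True}"

definition Ri_all :: "('f, 'p) rule" where
  "Ri_all = {([(\<Gamma>, {#A\<langle>x/FV a\<rangle>#})],
      (\<Gamma>, add_mset (All x A) \<Delta>)) | A x a \<Gamma> \<Delta>.
        a \<notin> fvs_sequent (\<Gamma>, add_mset (All x A) \<Delta>)}"

fun initial_sequents :: "logic \<Rightarrow> ('f, 'p) rule" where
  "initial_sequents Minimal = initial \<union> initial_bot"
| "initial_sequents Intuitionistic = initial \<union> L_bot"
| "initial_sequents Classical = initial \<union> L_bot"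

fun logical_rules :: "('f, 'p) language \<Rightarrow> logic \<Rightarrow> ('f, 'p) rule" where
  "logical_rules L Classical =
     L_and \<union> R_and \<union> L_or \<union> R_or \<union> L_imp \<union> R_imp \<union> L_all L \<union> R_all \<union> L_ex \<union> R_ex L"
| "logical_rules L _ =
     L_and \<union> R_and \<union> L_or \<union> R_or \<union> Li_imp \<union> Ri_imp \<union> L_all L \<union> Ri_all \<union> L_ex \<union> R_ex L"

definition G3 :: "('f, 'p) language \<Rightarrow> logic \<Rightarrow> ('f, 'p) rule" where
  "G3 L m = initial_sequents m \<union> logical_rules L m"

text \<open>The calculus with which a set of rules is identified, and the extension of G3 by these rules.\<close>

definition calculus_of :: "logic \<Rightarrow> ('f, 'p) rule set \<Rightarrow> ('f, 'p) rule" where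
  "calculus_of m \<R> = initial_sequents m \<union> \<Union> \<R>"

definition G3_ext :: "('f, 'p) language \<Rightarrow> logic \<Rightarrow> ('f, 'p) rule set \<Rightarrow> ('f, 'p) rule" where
  "G3_ext L m \<R> = G3 L m \<union> \<Union> \<R>"


section \<open>Structural rules\<close>

definition L_weakening :: "('f, 'p) rule" where
  "L_weakening = {([(\<Gamma>, \<Delta>)], (add_mset A \<Gamma>, \<Delta>)) | A \<Gamma> \<Delta>. True}"

definition R_weakening :: "('f, 'p) rule" where
  "R_weakening = {([(\<Gamma>, \<Delta>)], (\<Gamma>, add_mset A \<Delta>)) | A \<Gamma> \<Delta>. True}"

definition L_contraction :: "('f, 'p) rule" where
  "L_contraction = {([(add_mset A (add_mset A \<Gamma>), \<Delta>)], (add_mset A \<Gamma>, \<Delta>)) | A \<Gamma> \<Delta>. True}"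

definition R_contraction :: "('f, 'p) rule" where
  "R_contraction = {([(\<Gamma>, add_mset A (add_mset A \<Delta>))], (\<Gamma>, add_mset A \<Delta>)) | A \<Gamma> \<Delta>. True}"

definition Cut :: "('f, 'p) rule" where
  "Cut = {([(\<Gamma>, add_mset A \<Delta>), (add_mset A \<Lambda>, \<Theta>)], (\<Gamma> + \<Lambda>, \<Delta> + \<Theta>)) | A \<Gamma> \<Delta> \<Lambda> \<Theta>. True}"

definition structural_rules :: "('f, 'p) rule set" where
  "structural_rules = {L_weakening, R_weakening, L_contraction, R_contraction, Cut}"


section \<open>Equality rules\<close>

text \<open>
  The place marked by \<open>x\<close> in \<open>P\<close> is a bound variable.  Since premiss and conclusion of an instance
  used in a derivation are sequents of the language, \<open>r\<close> and \<open>s\<close> are terms of the language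
  and \<open>P\<close> contains no other bound variable.
\<close>

definition Ref :: "('f, 'p) rule" where
  "Ref = {([], (\<Gamma>, add_mset (Eq t t) \<Delta>)) | t \<Gamma> \<Delta>. True}"

definition Rep1r :: "('f, 'p) rule" where
  "Rep1r = {([(add_mset (Eq r s) \<Gamma>, add_mset (P\<langle>x/r\<rangle>) \<Delta>)],
      (add_mset (Eq r s) \<Gamma>, add_mset (P\<langle>x/s\<rangle>) \<Delta>)) | P x r s \<Gamma> \<Delta>. atomic P}"

definition Rep2r :: "('f, 'p) rule" where
  "Rep2r = {([(add_mset (Eq s r) \<Gamma>, add_mset (P\<langle>x/r\<rangle>) \<Delta>)],
      (add_mset (Eq s r) \<Gamma>, add_mset (P\<langle>x/s\<rangle>) \<Delta>)) | P x r s \<Gamma> \<Delta>. atomic P}"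

definition Rep1l_plus :: "('f, 'p) rule" where
  "Rep1l_plus =
     {([(add_mset (Eq r s) (add_mset (P\<langle>x/r\<rangle>) \<Gamma>), \<Delta>)],
       (add_mset (Eq r s) (add_mset (P\<langle>x/s\<rangle>) \<Gamma>), \<Delta>)) | P x r s \<Gamma> \<Delta>.
         atomic P \<and> \<not> is_equality P} \<union>
     {([(add_mset (Eq r s) (add_mset (E\<langle>x/s\<rangle>) (add_mset (E\<langle>x/r\<rangle>) \<Gamma>)), \<Delta>)],
       (add_mset (Eq r s) (add_mset (E\<langle>x/s\<rangle>) \<Gamma>), \<Delta>)) | E x r s \<Gamma> \<Delta>. is_equality E}"

definition Rep2l_plus :: "('f, 'p) rule" where
  "Rep2l_plus =
     {([(add_mset (Eq s r) (add_mset (P\<langle>x/r\<rangle>) \<Gamma>), \<Delta>)],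
       (add_mset (Eq s r) (add_mset (P\<langle>x/s\<rangle>) \<Gamma>), \<Delta>)) | P x r s \<Gamma> \<Delta>.
         atomic P \<and> \<not> is_equality P} \<union>
     {([(add_mset (Eq s r) (add_mset (E\<langle>x/s\<rangle>) (add_mset (E\<langle>x/r\<rangle>) \<Gamma>)), \<Delta>)],
       (add_mset (Eq s r) (add_mset (E\<langle>x/s\<rangle>) \<Gamma>), \<Delta>)) | E x r s \<Gamma> \<Delta>. is_equality E}"

definition R12r :: "('f, 'p) rule set" where
  "R12r = {Ref, Rep1r, Rep2r}"

definition R2rl_plus :: "('f, 'p) rule set" where
  "R2rl_plus = {Ref, Rep2l_plus, Rep2r}"

definition R1rl_plus :: "('f, 'p) rule set" where
  "R1rl_plus = {Ref, Rep1l_plus, Rep1r}"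

end

theory Submission
  imports Defs "HOL-Library.Confluence"
begin

text \<open>
  The calculi consisting of equality rules alone all derive the same sequents, and these can be
  described without derivations: some atom of the succedent follows from the antecedent by
  reflexivity, symmetry, transitivity and congruence (\<open>follows\<close>), or the sequent holds because of
  \<open>Bot\<close>.  Such sequents are called \<open>axiomatic\<close> here.  Axiomatic sequents are closed under
  contraction and cut, and every replacement rule is a cut with an axiomatic sequent followed by a
  contraction (\<open>equality_rules_sound\<close>); so nothing but axiomatic sequents is derivable.

  Conversely, read from the conclusion to the premiss, a replacement rule rewrites a term of an
  atom by an equation.  If equations may be used in both directions this reaches every congruent
  atom.  If they may be used in one direction only, the left rule still allows one to rewrite the
  left-hand side of one equation \<open>l = r\<close> by another one and to keep both.  Close the antecedent
  under these steps (\<open>completion\<close>).  When an equation \<open>l = r\<close> is applied at the root of \<open>l\<close> while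
  another one rewrites \<open>l\<close> to \<open>k\<close>, the equation \<open>k = r\<close> is available and closes the peak in one
  step; peaks at disjoint positions commute.  So rewriting is subcommutative, hence confluent, and
  congruent terms have a common reduct.  Rewriting both terms of an equality in the succedent to
  that reduct leads to a reflexivity axiom; rewriting the arguments of a predicate on both sides
  leads to an initial sequent (\<open>axiomatic_derivable_oriented\<close>).  The two orientations are treated
  at once, by means of a Boolean parameter.

  For the structural rules, let the axiomatic sequents be the initial sequents of a calculus
  \<open>prov\<close> that has the rules of G3 and no equality rules.  Since the replacement rules are cuts
  with axiomatic sequents, G3 with equality rules derives the same sequents as \<open>prov\<close>
  (\<open>G3_oriented_iff\<close>) as soon as contraction and cut are admissible in \<open>prov\<close>.  That is a
  cut-elimination theorem for purely logical rules over initial sequents closed under cut.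
  It is proved for a version of G3 in which the rules with an eigenvariable have one premiss for
  each term of the language.  Derivations then are infinitely branching, but no variable ever has
  to be renamed, and one can argue by induction on derivations instead of their heights.
  Eigenvariables are only met when comparing the two versions: a substitution lemma
  (\<open>prov_inst\<close>) passes from one fresh variable to all terms.
\<close>

section \<open>Terms, formulas and substitution\<close>

lemma subst_tm_closed: "wf_tm L X t \<Longrightarrow> x \<notin> X \<Longrightarrow> subst_tm t x r = t"
  by (induction t) (auto simp: map_idI)

lemma wf_tm_mono: "wf_tm L X t \<Longrightarrow> X \<subseteq> Y \<Longrightarrow> wf_tm L Y t"
  by (induction t) auto

lemma wf_subst_tm: "wf_tm L (insert x X) t \<Longrightarrow> is_term L r \<Longrightarrow> wf_tm L X (subst_tm t x r)"
  by (induction t) (auto simp: is_term_def intro: wf_tm_mono)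

lemma wf_subst: "wf_fm L (insert x X) A \<Longrightarrow> is_term L r \<Longrightarrow> wf_fm L X (A\<langle>x/r\<rangle>)"
proof (induction A arbitrary: X)
  case (All y A)
  then show ?case by (cases "y = x") (auto simp: insert_commute)
next
  case (Ex y A)
  then show ?case by (cases "y = x") (auto simp: insert_commute)
qed (auto simp: wf_subst_tm)

lemma finite_fvs_tm: "finite (fvs_tm t)"
  by (induction t) auto

lemma finite_fvs_fm: "finite (fvs_fm A)"
  by (induction A) (auto simp: finite_fvs_tm)

primrec inst_tm :: "(nat \<Rightarrow> 'f tm) \<Rightarrow> 'f tm \<Rightarrow> 'f tm" where
  "inst_tm \<sigma> (FV a) = \<sigma> a"
| "inst_tm \<sigma> (BV x) = BV x"
| "inst_tm \<sigma> (Fn f ts) = Fn f (map (inst_tm \<sigma>) ts)"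

primrec inst :: "(nat \<Rightarrow> 'f tm) \<Rightarrow> ('f, 'p) fm \<Rightarrow> ('f, 'p) fm" where
  "inst \<sigma> Bot = Bot"
| "inst \<sigma> (Pre p ts) = Pre p (map (inst_tm \<sigma>) ts)"
| "inst \<sigma> (Eq t u) = Eq (inst_tm \<sigma> t) (inst_tm \<sigma> u)"
| "inst \<sigma> (And A B) = And (inst \<sigma> A) (inst \<sigma> B)"
| "inst \<sigma> (Or A B) = Or (inst \<sigma> A) (inst \<sigma> B)"
| "inst \<sigma> (Imp A B) = Imp (inst \<sigma> A) (inst \<sigma> B)"
| "inst \<sigma> (All x A) = All x (inst \<sigma> A)"
| "inst \<sigma> (Ex x A) = Ex x (inst \<sigma> A)"

lemma inst_tm_subst:
  assumes "\<And>a. is_term L (\<sigma> a)"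
  shows "inst_tm \<sigma> (subst_tm t x r) = subst_tm (inst_tm \<sigma> t) x (inst_tm \<sigma> r)"
proof (induction t)
  case (FV a)
  have "wf_tm L {} (\<sigma> a)" using assms by (simp add: is_term_def)
  then show ?case by (simp add: subst_tm_closed)
qed auto

lemma inst_subst:
  "(\<And>a. is_term L (\<sigma> a)) \<Longrightarrow> inst \<sigma> (A\<langle>x/r\<rangle>) = (inst \<sigma> A)\<langle>x/inst_tm \<sigma> r\<rangle>"
  by (induction A) (simp_all add: inst_tm_subst[of L])

lemma inst_tm_cong: "(\<And>a. a \<in> fvs_tm t \<Longrightarrow> \<sigma> a = \<tau> a) \<Longrightarrow> inst_tm \<sigma> t = inst_tm \<tau> t"
  by (induction t) auto

lemma inst_cong: "(\<And>a. a \<in> fvs_fm A \<Longrightarrow> \<sigma> a = \<tau> a) \<Longrightarrow> inst \<sigma> A = inst \<tau> A"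
proof (induction A)
  case (Pre p ts)
  then show ?case by (auto intro!: inst_tm_cong)
next
  case (Eq t u)
  then show ?case by (auto intro!: inst_tm_cong)
qed auto

lemma inst_tm_FV: "inst_tm FV t = t"
  by (induction t) (auto simp: map_idI)

lemma inst_FV: "inst FV A = A"
  by (induction A) (auto simp: inst_tm_FV map_idI)

lemma is_term_inst: "is_term L t \<Longrightarrow> (\<And>a. is_term L (\<sigma> a)) \<Longrightarrow> is_term L (inst_tm \<sigma> t)"
  unfolding is_term_def by (induction t) auto


section \<open>Entailment of atoms\<close>

inductive equates :: "('f, 'p) fm set \<Rightarrow> 'f tm \<Rightarrow> 'f tm \<Rightarrow> bool" for H where
  base: "Eq t u \<in> H \<Longrightarrow> equates H t u"
| refl: "equates H t t"
| sym: "equates H t u \<Longrightarrow> equates H u t"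
| trans: "equates H t u \<Longrightarrow> equates H u v \<Longrightarrow> equates H t v"
| cong: "list_all2 (equates H) ts us \<Longrightarrow> equates H (Fn f ts) (Fn f us)"

text \<open>
  The minimal calculus treats \<open>Bot\<close> like an atom that follows from itself; in the other calculi
  \<open>Bot\<close> in the antecedent is a separate axiom, added in \<open>axiomatic\<close>.
\<close>

inductive follows :: "logic \<Rightarrow> ('f, 'p) fm set \<Rightarrow> ('f, 'p) fm \<Rightarrow> bool" for m H where
  Eq: "equates H t u \<Longrightarrow> follows m H (Eq t u)"
| Pre: "Pre p us \<in> H \<Longrightarrow> list_all2 (equates H) us ts \<Longrightarrow> follows m H (Pre p ts)"
| Bot: "Bot \<in> H \<Longrightarrow> m = Minimal \<Longrightarrow> follows m H Bot"

definition axiom_formula :: "logic \<Rightarrow> ('f, 'p) fm \<Rightarrow> bool" where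
  "axiom_formula m A \<longleftrightarrow> atomic A \<or> A = Bot \<and> m = Minimal"

lemma axiom_formula_simps [simp]:
  "axiom_formula m (Pre p ts)" "axiom_formula m (Eq t u)"
  "axiom_formula m Bot \<longleftrightarrow> m = Minimal"
  "\<not> axiom_formula m (And A B)" "\<not> axiom_formula m (Or A B)" "\<not> axiom_formula m (Imp A B)"
  "\<not> axiom_formula m (All x A)" "\<not> axiom_formula m (Ex x A)"
  by (auto simp: axiom_formula_def atomic_def is_equality_def)

lemma atomic_cases:
  assumes "atomic A"
  obtains p ts where "A = Pre p ts" | t u where "A = Eq t u"
  using assms by (auto simp: atomic_def is_equality_def)

lemma follows_axiom_formula: "follows m H A \<Longrightarrow> axiom_formula m A"
  by (cases rule: follows.cases) auto

lemma list_all2_equates_refl: "list_all2 (equates H) ts ts"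
  by (simp add: list_all2_same equates.refl)

lemma list_all2_equates_sym: "list_all2 (equates H) ts us \<Longrightarrow> list_all2 (equates H) us ts"
  by (auto simp: list_all2_conv_all_nth intro: equates.sym)

lemma list_all2_equates_trans:
  "list_all2 (equates H) ts us \<Longrightarrow> list_all2 (equates H) us vs \<Longrightarrow> list_all2 (equates H) ts vs"
  by (rule list_all2_trans[of "equates H"]) (blast intro: equates.trans)

lemma follows_hypothesis: "A \<in> H \<Longrightarrow> axiom_formula m A \<Longrightarrow> follows m H A"
  by (cases A) (auto intro: follows.intros equates.base list_all2_equates_refl)

lemma equates_cut:
  assumes "\<And>t u. Eq t u \<in> H \<Longrightarrow> equates H' t u"
  shows "equates H t u \<Longrightarrow> equates H' t u"
proof (induction rule: equates.induct)
  case (cong ts us f)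
  then show ?case by (auto intro!: equates.cong elim!: list_all2_mono)
qed (auto intro: assms equates.intros)

lemma follows_EqD: "follows m H (Eq t u) \<Longrightarrow> equates H t u"
  by (cases rule: follows.cases) auto

lemma follows_PreD:
  "follows m H (Pre p ts) \<Longrightarrow> \<exists>us. Pre p us \<in> H \<and> list_all2 (equates H) us ts"
  by (cases rule: follows.cases) auto

text \<open>
  Hypotheses that are not axiom formulas cannot contribute to the conclusion, so that only the
  others have to follow from \<open>H'\<close>.  Weakening, cut and the removal of compound formulas are all
  instances.
\<close>

lemma follows_cut:
  assumes H: "\<And>A. A \<in> H \<Longrightarrow> axiom_formula m A \<Longrightarrow> follows m H' A"
    and "follows m H C"
  shows "follows m H' C"
proof -
  have eq: "equates H t u \<Longrightarrow> equates H' t u" for t u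
    by (rule equates_cut) (auto dest: H follows_EqD)
  show ?thesis
    using assms(2)
  proof cases
    case (Eq t u)
    then show ?thesis by (auto intro: follows.Eq eq)
  next
    case (Pre p us ts)
    then have "follows m H' (Pre p us)" by (simp add: H)
    moreover have "list_all2 (equates H') us ts"
      using Pre by (auto elim!: list_all2_mono intro: eq)
    ultimately show ?thesis
      using Pre by (auto dest!: follows_PreD intro: follows.Pre list_all2_equates_trans)
  next
    case Bot
    then show ?thesis using H[of Bot] by simp
  qed
qed

lemma follows_mono: "follows m H C \<Longrightarrow> H \<subseteq> H' \<Longrightarrow> follows m H' C"
  by (rule follows_cut) (auto intro: follows_hypothesis)

lemma equates_inst: "equates H t u \<Longrightarrow> equates (inst \<sigma> ` H) (inst_tm \<sigma> t) (inst_tm \<sigma> u)"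
proof (induction rule: equates.induct)
  case (base t u)
  then show ?case by (force intro: equates.base)
next
  case (cong ts us f)
  then show ?case by (auto intro!: equates.cong simp: list_all2_conv_all_nth)
qed (auto intro: equates.intros)

lemma follows_inst: "follows m H C \<Longrightarrow> follows m (inst \<sigma> ` H) (inst \<sigma> C)"
proof (induction rule: follows.induct)
  case (Pre p us ts)
  then have "Pre p (map (inst_tm \<sigma>) us) \<in> inst \<sigma> ` H" by force
  with Pre show ?case
    by (auto intro!: follows.Pre equates_inst simp: list_all2_conv_all_nth)
qed (force intro: follows.intros equates_inst)+

lemma equates_subst_tm: "equates H r s \<Longrightarrow> equates H (subst_tm t x r) (subst_tm t x s)"
  by (induction t) (auto intro!: equates.refl equates.cong simp: list_all2_conv_all_nth)

lemma follows_replacement: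
  assumes "atomic P" "equates H r s"
  shows "follows m (insert (P\<langle>x/r\<rangle>) H) (P\<langle>x/s\<rangle>)"
proof -
  have "equates (insert (P\<langle>x/r\<rangle>) H) r s"
    using assms(2) by (rule equates_cut[rotated]) (auto intro: equates.base)
  note eq = equates_subst_tm[OF this, where x = x]
  from assms(1) show ?thesis
  proof (cases rule: atomic_cases)
    case (1 p ts)
    then show ?thesis
      using eq by (auto intro!: follows.Pre[of p "map (\<lambda>t. subst_tm t x r) ts"]
          simp: list_all2_conv_all_nth)
  next
    case (2 t u)
    let ?H = "insert (P\<langle>x/r\<rangle>) H"
    have "equates ?H (subst_tm t x r) (subst_tm u x r)"
      using 2 by (auto intro: equates.base)
    then have "equates ?H (subst_tm t x s) (subst_tm u x s)"
      using eq[of t] eq[of u] by (blast intro: equates.intros)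
    then show ?thesis
      using 2 by (auto intro: follows.Eq)
  qed
qed


section \<open>A calculus of signed formulas without eigenvariables\<close>

text \<open>
  A two-sided sequent is represented by one multiset of formulas marked with their side, so that
  the left and right rules become instances of a single scheme and need a single proof.
\<close>

datatype 'a signed = is_Left: Left (formula: 'a) | Right (formula: 'a)

definition hyps :: "('f, 'p) fm signed multiset \<Rightarrow> ('f, 'p) fm set" where
  "hyps \<Sigma> = {A. Left A \<in># \<Sigma>}"

lemma hyps_simps [simp]:
  "hyps {#} = {}"
  "hyps (add_mset (Left A) \<Sigma>) = insert A (hyps \<Sigma>)"
  "hyps (add_mset (Right A) \<Sigma>) = hyps \<Sigma>"
  "hyps (\<Sigma> + \<Sigma>') = hyps \<Sigma> \<union> hyps \<Sigma>'"
  "hyps (filter_mset is_Left \<Sigma>) = hyps \<Sigma>"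
  by (auto simp: hyps_def)

lemma filter_Left_idem [simp]:
  "filter_mset is_Left (filter_mset is_Left \<Sigma>) = filter_mset is_Left \<Sigma>"
  by (induction \<Sigma>) auto

definition axiomatic :: "logic \<Rightarrow> ('f, 'p) fm signed multiset \<Rightarrow> bool" where
  "axiomatic m \<Sigma> \<longleftrightarrow>
    (\<exists>P. Right P \<in># \<Sigma> \<and> follows m (hyps \<Sigma>) P) \<or> m \<noteq> Minimal \<and> Left Bot \<in># \<Sigma>"

text \<open>
  The principal formulas whose rule discards the remaining succedent, as \<open>Ri_imp\<close> and \<open>Ri_all\<close> do.
\<close>

fun single_succedent :: "logic \<Rightarrow> ('f, 'p) fm signed \<Rightarrow> bool" where
  "single_succedent m (Right (Imp A B)) \<longleftrightarrow> m \<noteq> Classical"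
| "single_succedent m (Right (All x A)) \<longleftrightarrow> m \<noteq> Classical"
| "single_succedent m _ \<longleftrightarrow> False"

definition kept_context :: "logic \<Rightarrow> ('f, 'p) fm signed \<Rightarrow> ('f, 'p) fm signed multiset \<Rightarrow> ('f, 'p) fm signed multiset" where
  "kept_context m \<phi> \<Sigma> = (if single_succedent m \<phi> then filter_mset is_Left \<Sigma> else \<Sigma>)"

text \<open>
  The set contains the active formulas of each premiss.  A principal formula that the rule repeats
  in a premiss is listed among the active ones.  \<open>Right (All x A)\<close> and \<open>Left (Ex x A)\<close>, whose usual
  rules have an eigenvariable, get one premiss for every term of the language.
\<close>

inductive decomp ::
  "('f, 'p) language \<Rightarrow> logic \<Rightarrow> ('f, 'p) fm signed \<Rightarrow> ('f, 'p) fm signed multiset set \<Rightarrow> bool"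
  for L m where
  LAnd: "decomp L m (Left (And A B)) {{#Left A, Left B#}}"
| RAnd: "decomp L m (Right (And A B)) {{#Right A#}, {#Right B#}}"
| LOr: "decomp L m (Left (Or A B)) {{#Left A#}, {#Left B#}}"
| ROr: "decomp L m (Right (Or A B)) {{#Right A, Right B#}}"
| LImp: "decomp L m (Left (Imp A B))
    {add_mset (Right A) (if m = Classical then {#} else {#Left (Imp A B)#}), {#Left B#}}"
| RImp: "decomp L m (Right (Imp A B)) {{#Left A, Right B#}}"
| LAll: "is_term L t \<Longrightarrow> decomp L m (Left (All x A)) {{#Left (A\<langle>x/t\<rangle>), Left (All x A)#}}"
| RAll: "decomp L m (Right (All x A)) {{#Right (A\<langle>x/t\<rangle>)#} |t. is_term L t}"
| LEx: "decomp L m (Left (Ex x A)) {{#Left (A\<langle>x/t\<rangle>)#} |t. is_term L t}"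
| REx: "is_term L t \<Longrightarrow> decomp L m (Right (Ex x A)) {{#Right (A\<langle>x/t\<rangle>), Right (Ex x A)#}}"

inductive prov :: "('f, 'p) language \<Rightarrow> logic \<Rightarrow> ('f, 'p) fm signed multiset \<Rightarrow> bool"
  for L m where
  axiom: "axiomatic m \<Sigma> \<Longrightarrow> prov L m \<Sigma>"
| rule: "decomp L m \<phi> Ps \<Longrightarrow> (\<And>P. P \<in> Ps \<Longrightarrow> prov L m (P + kept_context m \<phi> \<Sigma>)) \<Longrightarrow>
    prov L m (add_mset \<phi> \<Sigma>)"

primrec depth :: "('f, 'p) fm \<Rightarrow> nat" where
  "depth Bot = 0"
| "depth (Pre p ts) = 0"
| "depth (Eq t u) = 0"
| "depth (And A B) = Suc (depth A + depth B)"
| "depth (Or A B) = Suc (depth A + depth B)"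
| "depth (Imp A B) = Suc (depth A + depth B)"
| "depth (All x A) = Suc (depth A)"
| "depth (Ex x A) = Suc (depth A)"

lemma depth_subst [simp]: "depth (A\<langle>x/t\<rangle>) = depth A"
  by (induction A) auto

abbreviation signed_depth :: "('f, 'p) fm signed \<Rightarrow> nat" where
  "signed_depth \<phi> \<equiv> depth (formula \<phi>)"

lemma decomp_depth:
  "decomp L m \<phi> Ps \<Longrightarrow> P \<in> Ps \<Longrightarrow> \<chi> \<in># P \<Longrightarrow> \<chi> = \<phi> \<or> signed_depth \<chi> < signed_depth \<phi>"
  by (cases rule: decomp.cases) (auto split: if_splits)

lemma kept_context_simps [simp]:
  "kept_context m \<phi> (\<Sigma> + \<Sigma>') = kept_context m \<phi> \<Sigma> + kept_context m \<phi> \<Sigma>'"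
  "kept_context m \<phi> (add_mset (Left A) \<Sigma>) = add_mset (Left A) (kept_context m \<phi> \<Sigma>)"
  "kept_context m (Left B) \<Sigma> = \<Sigma>"
  "single_succedent m \<phi> \<Longrightarrow> kept_context m \<phi> (add_mset (Right A) \<Sigma>) = kept_context m \<phi> \<Sigma>"
  "\<not> single_succedent m \<phi> \<Longrightarrow> kept_context m \<phi> \<Sigma> = \<Sigma>"
  "kept_context m \<phi> (kept_context m \<phi> \<Sigma>) = kept_context m \<phi> \<Sigma>"
  by (auto simp: kept_context_def)

lemma single_succedentD: "single_succedent m \<phi> \<Longrightarrow> m \<noteq> Classical \<and> (\<exists>A. \<phi> = Right A)"
  by (cases "(m, \<phi>)" rule: single_succedent.cases) auto


section \<open>Weakening, inversion and contraction\<close>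

lemma axiomatic_mono: "axiomatic m \<Sigma> \<Longrightarrow> set_mset \<Sigma> \<subseteq> set_mset \<Sigma>' \<Longrightarrow> axiomatic m \<Sigma>'"
  using follows_mono[of m "hyps \<Sigma>" _ "hyps \<Sigma>'"] unfolding axiomatic_def hyps_def by blast

lemma prov_axiomatic: "axiomatic m \<Sigma> \<Longrightarrow> set_mset \<Sigma> \<subseteq> set_mset \<Sigma>' \<Longrightarrow> prov L m \<Sigma>'"
  by (rule prov.axiom) (rule axiomatic_mono)

lemma axiomatic_cut:
  assumes "follows m (hyps \<Gamma>) C" "axiomatic m (add_mset (Left C) \<Lambda>)"
  shows "axiomatic m (\<Gamma> + \<Lambda>)"
proof -
  have cut: "follows m (hyps (\<Gamma> + \<Lambda>)) P" if "follows m (insert C (hyps \<Lambda>)) P" for P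
    using _ that
  proof (rule follows_cut)
    fix A assume "A \<in> insert C (hyps \<Lambda>)" "axiom_formula m A"
    then show "follows m (hyps (\<Gamma> + \<Lambda>)) A"
      using follows_mono[OF assms(1), of "hyps (\<Gamma> + \<Lambda>)"] by (auto intro: follows_hypothesis)
  qed
  show ?thesis
    using assms(2) cut follows_axiom_formula[OF assms(1)] by (auto simp: axiomatic_def)
qed

text \<open>
  Axiomatic sequents owe their validity to atoms and \<open>Bot\<close> alone, and \<open>\<phi>\<close> is compound.
\<close>

lemma axiomatic_compound:
  assumes "axiomatic m (add_mset \<phi> \<Sigma>)" "decomp L m \<phi> Ps"
  shows "axiomatic m \<Sigma>"
proof -
  obtain C where \<phi>: "\<phi> = Left C \<or> \<phi> = Right C" and C: "\<not> axiom_formula m C" "C \<noteq> Bot"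
    using assms(2) by cases auto
  have "follows m (hyps \<Sigma>) P" if "follows m (hyps (add_mset \<phi> \<Sigma>)) P" for P
    using _ that by (rule follows_cut) (use \<phi> C in \<open>auto intro: follows_hypothesis\<close>)
  moreover from this have "P \<noteq> C" if "follows m (hyps (add_mset \<phi> \<Sigma>)) P" for P
    using C that by (auto dest: follows_axiom_formula)
  ultimately show ?thesis
    using assms(1) \<phi> C by (auto simp: axiomatic_def simp del: hyps_simps)
qed

lemma weakening: "prov L m \<Sigma> \<Longrightarrow> prov L m (\<Sigma> + \<Sigma>')"
proof (induction arbitrary: \<Sigma>' rule: prov.induct)
  case (axiom \<Sigma>)
  then show ?case by (rule prov_axiomatic) auto
next
  case (rule \<phi> Ps \<Sigma>)
  have "prov L m (P + kept_context m \<phi> (\<Sigma> + \<Sigma>'))" if "P \<in> Ps" for P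
    using rule.IH[OF that, of "kept_context m \<phi> \<Sigma>'"] by (simp add: add.assoc)
  from prov.rule[OF rule.hyps(1) this] show ?case by simp
qed

lemma weakening_subset: "prov L m \<Sigma> \<Longrightarrow> \<Sigma> \<subseteq># \<Sigma>' \<Longrightarrow> prov L m \<Sigma>'"
  by (metis weakening subset_mset.add_diff_inverse)

text \<open>
  Only \<open>Left (All x A)\<close> and \<open>Right (Ex x A)\<close> have several decompositions, one for each term,
  and these repeat the principal formula.
\<close>

lemma decomp_unique:
  assumes "decomp L m \<phi> Ps" "P \<in> Ps" "\<phi> \<notin># P" "decomp L m \<phi> Qs"
  shows "P \<in> Qs"
  using assms by (cases rule: decomp.cases) (auto elim: decomp.cases)

text \<open>
  What makes left inversion work in front of a rule that discards the succedent: the active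
  formulas survive such a rule.  The first premiss of \<open>Li_imp\<close> has an active formula
  on the right, but it repeats the principal formula.
\<close>

lemma component_Left:
  assumes "decomp L m (Left A) Ps" "P \<in> Ps" "Left A \<notin># P" "m \<noteq> Classical"
  shows "filter_mset is_Left P = P"
  using assms by (cases rule: decomp.cases) auto

text \<open>
  Every rule instance with another principal formula commutes with the replacement of \<open>\<phi>\<close> by \<open>P\<close>.
  If that rule discards the succedent, either \<open>\<phi>\<close> and all of \<open>P\<close> stand on the left and are kept, or
  \<open>\<phi>\<close> stands on the right and disappears, so that \<open>P\<close> is added by weakening.
\<close>

lemma inversion:
  assumes "prov L m (add_mset \<phi> \<Gamma>)"
    and \<phi>: "decomp L m \<phi> Ps" "P \<in> Ps" "\<phi> \<notin># P" "\<not> single_succedent m \<phi>"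
  shows "prov L m (P + \<Gamma>)"
  using assms(1)
proof (induction "add_mset \<phi> \<Gamma>" arbitrary: \<Gamma> rule: prov.induct)
  case axiom
  then have "axiomatic m \<Gamma>" using \<phi>(1) by (rule axiomatic_compound)
  then show ?case by (rule prov_axiomatic) auto
next
  case (rule \<psi> Qs \<Sigma>)
  from rule.hyps(4) consider (same) "\<psi> = \<phi>" "\<Sigma> = \<Gamma>"
    | (other) K where "\<Sigma> = add_mset \<phi> K" "\<Gamma> = add_mset \<psi> K"
    by (auto simp: add_eq_conv_ex)
  then show ?case
  proof cases
    case same
    then have "P \<in> Qs" using decomp_unique[OF \<phi>(1-3)] rule.hyps(1) by simp
    then show ?thesis using rule.hyps(2)[of P] \<phi>(4) same by simp
  next
    case other
    have "prov L m (Q + kept_context m \<psi> (P + K))" if Q: "Q \<in> Qs" for Q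
    proof (cases "single_succedent m \<psi>")
      case False
      then show ?thesis
        using rule.hyps(3)[OF Q, of "Q + K"] by (simp add: other add.left_commute)
    next
      case True
      then have m: "m \<noteq> Classical" by (simp add: single_succedentD)
      show ?thesis
      proof (cases \<phi>)
        case (Left A)
        then have "kept_context m \<psi> P = P"
          using component_Left[of L m A] \<phi> m True by (simp add: kept_context_def)
        then show ?thesis
          using rule.hyps(3)[OF Q, of "Q + kept_context m \<psi> K"] by (simp add: other Left add.left_commute)
      next
        case (Right A)
        then have "prov L m (Q + kept_context m \<psi> K)"
          using rule.hyps(2)[OF Q] True by (simp add: other)
        then show ?thesis by (rule weakening_subset) simp
      qed
    qed
    from prov.rule[OF rule.hyps(1) this] show ?thesis by (simp add: other)
  qed
qed

lemma contraction_components: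
  assumes "\<And>\<chi> \<Gamma>. \<chi> \<in># P \<Longrightarrow> prov L m (add_mset \<chi> (add_mset \<chi> \<Gamma>)) \<Longrightarrow> prov L m (add_mset \<chi> \<Gamma>)"
    and "prov L m (P + P + \<Gamma>)"
  shows "prov L m (P + \<Gamma>)"
  using assms
proof (induction P arbitrary: \<Gamma>)
  case (add \<chi> P)
  have "prov L m (P + P + add_mset \<chi> \<Gamma>)"
    using add.prems(1)[of \<chi> "P + P + \<Gamma>"] add.prems(2) by simp
  then have "prov L m (P + add_mset \<chi> \<Gamma>)"
    by (rule add.IH[rotated]) (rule add.prems(1), simp_all)
  then show ?case by simp
qed simp

text \<open>
  Induction on the depth of \<open>\<phi>\<close>, then on the derivation.  When \<open>\<phi>\<close> is principal in the last rule,
  there are three possibilities for a premiss: the rule discards the second copy of \<open>\<phi>\<close> along with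
  the succedent; or the premiss repeats \<open>\<phi>\<close>, and the inner induction hypothesis applies; or the
  second copy can be inverted, which duplicates the active formulas, and the outer induction
  hypothesis contracts these.  The outer induction does not look at derivations, so inversion may
  change them arbitrarily.
\<close>

lemma contraction_formula: "prov L m (add_mset \<phi> (add_mset \<phi> \<Gamma>)) \<Longrightarrow> prov L m (add_mset \<phi> \<Gamma>)"
proof (induction "signed_depth \<phi>" arbitrary: \<phi> \<Gamma> rule: less_induct)
  case less
  note smaller = less.hyps
  from less.prems show ?case
  proof (induction "add_mset \<phi> (add_mset \<phi> \<Gamma>)" arbitrary: \<Gamma> rule: prov.induct)
    case axiom
    then show ?case by (rule prov_axiomatic) auto
  next
    case (rule \<psi> Ps \<Sigma>)
    from rule.hyps(4) consider (same) "\<psi> = \<phi>" "\<Sigma> = add_mset \<phi> \<Gamma>"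
      | (other) K where "\<Gamma> = add_mset \<psi> K" "\<Sigma> = add_mset \<phi> (add_mset \<phi> K)"
      by (auto simp: add_eq_conv_ex)
    then show ?case
    proof cases
      case same
      have "prov L m (P + kept_context m \<phi> \<Gamma>)" if P: "P \<in> Ps" for P
      proof (cases "single_succedent m \<phi>")
        case True
        then show ?thesis
          using rule.hyps(2)[OF P] single_succedentD[OF True] by (auto simp: same)
      next
        case ss: False
        show ?thesis
        proof (cases "\<phi> \<in># P")
          case True
          then obtain P' where P': "P = add_mset \<phi> P'" by (auto dest: multi_member_split)
          then show ?thesis
            using rule.hyps(3)[OF P, of "P' + \<Gamma>"] ss by (simp add: same)
        next
          case False
          have "prov L m (P + P + \<Gamma>)"
            using inversion[of L m \<phi> "P + \<Gamma>" Ps P] rule.hyps(1) rule.hyps(2)[OF P] P False ss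
            by (simp add: same add.assoc)
          then have "prov L m (P + \<Gamma>)"
          proof (rule contraction_components[rotated])
            fix \<chi> \<Gamma> assume "\<chi> \<in># P" "prov L m (add_mset \<chi> (add_mset \<chi> \<Gamma>))"
            then show "prov L m (add_mset \<chi> \<Gamma>)"
              using smaller decomp_depth[OF rule.hyps(1) P] False by (auto simp: same)
          qed
          then show ?thesis using ss by simp
        qed
      qed
      then show ?thesis using prov.rule[of L m \<phi> Ps \<Gamma>] rule.hyps(1) by (simp add: same)
    next
      case other
      have "prov L m (P + kept_context m \<psi> (add_mset \<phi> K))" if P: "P \<in> Ps" for P
      proof (cases "single_succedent m \<psi> \<and> \<not> is_Left \<phi>")
        case True
        then show ?thesis using rule.hyps(2)[OF P] by (cases \<phi>) (auto simp: other)
      next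
        case False
        then have "kept_context m \<psi> (add_mset \<phi> M) = add_mset \<phi> (kept_context m \<psi> M)" for M
          by (cases \<phi>) (auto simp: kept_context_def)
        then show ?thesis
          using rule.hyps(3)[OF P, of "P + kept_context m \<psi> K"] by (simp add: other)
      qed
      from prov.rule[OF rule.hyps(1) this] show ?thesis
        by (simp add: other add_mset_commute)
    qed
  qed
qed

lemma contraction: "prov L m (\<Delta> + \<Delta> + \<Gamma>) \<Longrightarrow> prov L m (\<Delta> + \<Gamma>)"
  by (rule contraction_components) (auto intro: contraction_formula)


section \<open>Cut\<close>

text \<open>
  Permutes a cut upwards in the derivation that uses the cut formula \<open>C\<close> on the left, until \<open>C\<close> is
  principal there or an axiom is reached.  The context \<open>\<Gamma>\<close> stems from the other premiss of the cut;
  since it must pass through rules that discard the succedent, it may only consist of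
  antecedent formulas unless the calculus is classical.
\<close>

lemma cut_right_principal:
  assumes "prov L m (add_mset (Left C) \<Lambda>)"
    and \<Gamma>: "m \<noteq> Classical \<Longrightarrow> filter_mset is_Left \<Gamma> = \<Gamma>"
    and axiom: "\<And>\<Lambda>. axiomatic m (add_mset (Left C) \<Lambda>) \<Longrightarrow> prov L m (\<Gamma> + \<Lambda>)"
    and principal: "\<And>Ps \<Lambda>. decomp L m (Left C) Ps \<Longrightarrow>
      (\<And>P. P \<in> Ps \<Longrightarrow> prov L m (P - {#Left C#} + (\<Gamma> + \<Lambda>))) \<Longrightarrow> prov L m (\<Gamma> + \<Lambda>)"
  shows "prov L m (\<Gamma> + \<Lambda>)"
  using assms(1)
proof (induction "add_mset (Left C) \<Lambda>" arbitrary: \<Lambda> rule: prov.induct)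
  case axiom
  then show ?case by (rule assms(3))
next
  case (rule \<psi> Ps \<Sigma>)
  from rule.hyps(4) consider (same) "\<psi> = Left C" "\<Sigma> = \<Lambda>"
    | (other) K where "\<Sigma> = add_mset (Left C) K" "\<Lambda> = add_mset \<psi> K"
    by (auto simp: add_eq_conv_ex)
  then show ?case
  proof cases
    case same
    show ?thesis
    proof (rule principal)
      show "decomp L m (Left C) Ps" using rule.hyps(1) by (simp add: same)
      fix P assume P: "P \<in> Ps"
      show "prov L m (P - {#Left C#} + (\<Gamma> + \<Lambda>))"
      proof (cases "Left C \<in># P")
        case True
        then obtain P' where P': "P = add_mset (Left C) P'" by (auto dest: multi_member_split)
        then show ?thesis
          using rule.hyps(3)[OF P, of "P' + \<Lambda>"] by (simp add: same ac_simps)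
      next
        case False
        then have "prov L m (P + \<Lambda>)" using rule.hyps(2)[OF P] by (simp add: same)
        then show ?thesis by (rule weakening_subset) (simp add: False)
      qed
    qed
  next
    case other
    have kept_context: "kept_context m \<psi> \<Gamma> = \<Gamma>"
      using \<Gamma> single_succedentD[of m \<psi>] by (auto simp: kept_context_def)
    have "prov L m (P + kept_context m \<psi> (\<Gamma> + K))" if P: "P \<in> Ps" for P
      using rule.hyps(3)[OF P, of "P + kept_context m \<psi> K"] by (simp add: other kept_context ac_simps)
    from prov.rule[OF rule.hyps(1) this] show ?thesis by (simp add: other)
  qed
qed

text \<open>
  Discharges the axiom case of \<open>cut_right_principal\<close> for a compound cut formula.
\<close>

lemma axiomatic_Left_compound:
  "axiomatic m (add_mset (Left C) \<Lambda>) \<Longrightarrow> decomp L m (Left C) Ps \<Longrightarrow> prov L m (\<Gamma> + \<Lambda>)"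
  by (rule prov_axiomatic[OF axiomatic_compound]) auto

text \<open>
  Induction on the depth of \<open>C\<close>, then on the derivation of the premiss with \<open>C\<close> on the right.  When
  \<open>C\<close> is principal there, a conjunction, disjunction or existential formula is inverted in the
  other premiss.  Universal formulas and, outside the classical calculus, implications are not
  invertible on the left.  For these two connectives the cut is permuted upwards in the other
  premiss; this is possible because outside the classical calculus their right rules discard the
  succedent.  The same applies to a cut formula introduced by an axiom, since an axiomatic sequent
  needs no succedent formula besides the one that follows.
\<close>

lemma cut: "prov L m (add_mset (Right C) \<Gamma>) \<Longrightarrow> prov L m (add_mset (Left C) \<Lambda>) \<Longrightarrow> prov L m (\<Gamma> + \<Lambda>)"
proof (induction "depth C" arbitrary: C \<Gamma> \<Lambda> rule: less_induct)
  case less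
  have cut_smaller: "prov L m \<Sigma>"
    if "depth A < depth C" "prov L m (add_mset (Right A) \<Sigma>)" "prov L m (add_mset (Left A) \<Sigma>)"
    for A \<Sigma>
    using less.hyps[OF that] contraction[of L m \<Sigma> "{#}"] by simp
  have wk: "prov L m \<Sigma>'" if "prov L m \<Sigma>" "\<Sigma> \<subseteq># \<Sigma>'" for \<Sigma> \<Sigma>'
    using that by (rule weakening_subset)
  from less.prems show ?case
  proof (induction "add_mset (Right C) \<Gamma>" arbitrary: \<Gamma> \<Lambda> rule: prov.induct)
    \<comment> \<open>Either another formula makes the sequent axiomatic, or \<open>C\<close> itself follows from \<open>\<Gamma>\<close>.\<close>
    case axiom
    then consider "axiomatic m \<Gamma>" | "follows m (hyps \<Gamma>) C"
      by (auto simp: axiomatic_def)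
    then show ?case
    proof cases
      case 1
      then show ?thesis by (rule prov_axiomatic) auto
    next
      case 2
      then have C: "axiom_formula m C" by (rule follows_axiom_formula)
      have "prov L m (filter_mset is_Left \<Gamma> + \<Lambda>)"
        using axiom.prems
      proof (rule cut_right_principal)
        fix \<Lambda> assume "axiomatic m (add_mset (Left C) \<Lambda>)"
        then show "prov L m (filter_mset is_Left \<Gamma> + \<Lambda>)"
          using 2 by (simp add: prov.axiom axiomatic_cut)
      next
        fix Ps \<Lambda> assume "decomp L m (Left C) Ps"
        then show "prov L m (filter_mset is_Left \<Gamma> + \<Lambda>)"
          using C by cases auto
      qed simp
      then show ?thesis by (rule wk) simp
    qed
  next
    case (rule \<psi> Ps \<Sigma>)
    from rule.hyps(4) consider (same) "\<psi> = Right C" "\<Sigma> = \<Gamma>"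
      | (other) K where "\<Sigma> = add_mset (Right C) K" "\<Gamma> = add_mset \<psi> K"
      by (auto simp: add_eq_conv_ex)
    then show ?case
    proof cases
      case other
      have "prov L m (P + kept_context m \<psi> (K + \<Lambda>))" if P: "P \<in> Ps" for P
      proof (cases "single_succedent m \<psi>")
        case True
        then have "prov L m (P + kept_context m \<psi> K)" using rule.hyps(2)[OF P] by (simp add: other)
        then show ?thesis by (rule wk) simp
      next
        case False
        then show ?thesis
          using rule.hyps(3)[OF P, of "P + K" \<Lambda>] rule.prems by (simp add: other ac_simps)
      qed
      from prov.rule[OF rule.hyps(1) this] show ?thesis by (simp add: other)
    next
      case same
      note dec = rule.hyps(1)[unfolded same]
      note prem = rule.hyps(2)[unfolded same]
      note IH = rule.hyps(3)[unfolded same]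
      note D2 = rule.prems
      show ?thesis
        using dec
      proof cases
        case (RAnd A B)
        have "prov L m (add_mset (Right A) \<Gamma>)" and B: "prov L m (add_mset (Right B) \<Gamma>)"
          using prem[of "{#Right A#}"] prem[of "{#Right B#}"] RAnd by simp_all
        moreover have "prov L m (add_mset (Left A) (add_mset (Left B) \<Lambda>))"
          using inversion[OF D2[unfolded RAnd(1)] decomp.LAnd] by simp
        ultimately have "prov L m (add_mset (Left B) (\<Gamma> + \<Lambda>))"
          using less.hyps[of A \<Gamma> "add_mset (Left B) \<Lambda>"] RAnd by simp
        moreover have "prov L m (add_mset (Right B) (\<Gamma> + \<Lambda>))"
          using B by (rule wk) simp
        ultimately show ?thesis
          using cut_smaller[of B "\<Gamma> + \<Lambda>"] RAnd by simp
      next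
        case (ROr A B)
        have "prov L m (add_mset (Right A) (add_mset (Right B) \<Gamma>))"
          using prem[of "{#Right A, Right B#}"] ROr by simp
        moreover have "prov L m (add_mset (Left A) \<Lambda>)" and B: "prov L m (add_mset (Left B) \<Lambda>)"
          using inversion[OF D2[unfolded ROr(1)] decomp.LOr, of "{#Left A#}"]
            inversion[OF D2[unfolded ROr(1)] decomp.LOr, of "{#Left B#}"] by simp_all
        ultimately have "prov L m (add_mset (Right B) (\<Gamma> + \<Lambda>))"
          using less.hyps[of A "add_mset (Right B) \<Gamma>" \<Lambda>] ROr by simp
        moreover have "prov L m (add_mset (Left B) (\<Gamma> + \<Lambda>))"
          using B by (rule wk) simp
        ultimately show ?thesis
          using cut_smaller[of B "\<Gamma> + \<Lambda>"] ROr by simp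
      next
        case (RImp A B)
        let ?\<Gamma> = "kept_context m (Right C) \<Gamma>"
        have AB: "prov L m (add_mset (Left A) (add_mset (Right B) ?\<Gamma>))"
          using prem[of "{#Left A, Right B#}"] RImp by simp
        have "prov L m (?\<Gamma> + \<Lambda>)"
          using D2
        proof (rule cut_right_principal)
          fix \<Lambda> assume "axiomatic m (add_mset (Left C) \<Lambda>)"
          then show "prov L m (?\<Gamma> + \<Lambda>)"
            using decomp.LImp unfolding RImp(1) by (rule axiomatic_Left_compound)
        next
          fix Ps \<Lambda>
          assume "decomp L m (Left C) Ps"
            and *: "\<And>P. P \<in> Ps \<Longrightarrow> prov L m (P - {#Left C#} + (?\<Gamma> + \<Lambda>))"
          then have Ps: "Ps =
              {add_mset (Right A) (if m = Classical then {#} else {#Left C#}), {#Left B#}}"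
            by cases (simp_all add: RImp)
          have "prov L m (add_mset (Right A) (?\<Gamma> + \<Lambda>))"
            using *[of "add_mset (Right A) (if m = Classical then {#} else {#Left C#})"]
            by (auto simp: Ps split: if_splits)
          then have "prov L m (add_mset (Right B) (?\<Gamma> + \<Lambda> + ?\<Gamma>))"
            using less.hyps[of A "?\<Gamma> + \<Lambda>" "add_mset (Right B) ?\<Gamma>"] AB RImp by simp
          then have "prov L m (add_mset (Right B) (?\<Gamma> + \<Lambda>))"
            using contraction[of L m ?\<Gamma> "add_mset (Right B) \<Lambda>"] by (simp add: ac_simps)
          moreover have "prov L m (add_mset (Left B) (?\<Gamma> + \<Lambda>))"
            using *[of "{#Left B#}"] by (auto simp: Ps RImp diff_single_trivial)
          ultimately show "prov L m (?\<Gamma> + \<Lambda>)"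
            using cut_smaller[of B] RImp by simp
        qed (simp add: kept_context_def RImp)
        then show ?thesis by (rule wk) (simp add: kept_context_def)
      next
        case (RAll x A)
        let ?\<Gamma> = "kept_context m (Right C) \<Gamma>"
        have "prov L m (?\<Gamma> + \<Lambda>)"
          using D2
        proof (rule cut_right_principal)
          fix \<Lambda> assume "axiomatic m (add_mset (Left C) \<Lambda>)"
          \<comment> \<open>Any term will do: only that \<open>C\<close> is compound matters here.\<close>
          then show "prov L m (?\<Gamma> + \<Lambda>)"
            using decomp.LAll[of L "FV 0" m x A] unfolding RAll(1)
            by (rule axiomatic_Left_compound) (simp add: is_term_def)
        next
          fix Ps \<Lambda>
          assume "decomp L m (Left C) Ps"
            and *: "\<And>P. P \<in> Ps \<Longrightarrow> prov L m (P - {#Left C#} + (?\<Gamma> + \<Lambda>))"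
          then obtain t where t: "is_term L t" and Ps: "Ps = {{#Left (A\<langle>x/t\<rangle>), Left C#}}"
            by cases (auto simp: RAll)
          have "prov L m (add_mset (Left (A\<langle>x/t\<rangle>)) (?\<Gamma> + \<Lambda>))"
            using *[of "{#Left (A\<langle>x/t\<rangle>), Left C#}"] by (simp add: Ps add_mset_commute)
          moreover have "prov L m (add_mset (Right (A\<langle>x/t\<rangle>)) (?\<Gamma> + \<Lambda>))"
            using prem[of "{#Right (A\<langle>x/t\<rangle>)#}"] t by (rule_tac wk) (auto simp: RAll)
          ultimately show "prov L m (?\<Gamma> + \<Lambda>)"
            using cut_smaller[of "A\<langle>x/t\<rangle>"] RAll by simp
        qed (simp add: kept_context_def RAll)
        then show ?thesis by (rule wk) (simp add: kept_context_def)
      next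
        case (REx t x A)
        have "prov L m (add_mset (Right (A\<langle>x/t\<rangle>)) (\<Gamma> + \<Lambda>))"
          using IH[of "{#Right (A\<langle>x/t\<rangle>), Right C#}" "add_mset (Right (A\<langle>x/t\<rangle>)) \<Gamma>"] REx D2
          by (simp add: add_mset_commute)
        moreover have "Ex x A \<noteq> A\<langle>x/t\<rangle>"
          using depth_subst[of A x t] by (metis depth.simps(8) n_not_Suc_n)
        then have "prov L m (add_mset (Left (A\<langle>x/t\<rangle>)) \<Lambda>)"
          using inversion[OF D2[unfolded REx(1)] decomp.LEx, of "{#Left (A\<langle>x/t\<rangle>)#}"] REx by auto
        then have "prov L m (add_mset (Left (A\<langle>x/t\<rangle>)) (\<Gamma> + \<Lambda>))" by (rule wk) simp
        ultimately show ?thesis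
          using cut_smaller[of "A\<langle>x/t\<rangle>"] REx by simp
      qed
    qed
  qed
qed


section \<open>Substitution for free variables\<close>

abbreviation inst_seq ::
  "(nat \<Rightarrow> 'f tm) \<Rightarrow> ('f, 'p) fm signed multiset \<Rightarrow> ('f, 'p) fm signed multiset" where
  "inst_seq \<sigma> \<equiv> image_mset (map_signed (inst \<sigma>))"

definition fvs_signed :: "('f, 'p) fm signed multiset \<Rightarrow> nat set" where
  "fvs_signed \<Sigma> = (\<Union>\<phi> \<in> set_mset \<Sigma>. fvs_fm (formula \<phi>))"

lemma fvs_signed_simps [simp]:
  "fvs_signed {#} = {}"
  "fvs_signed (add_mset \<phi> \<Sigma>) = fvs_fm (formula \<phi>) \<union> fvs_signed \<Sigma>"
  "fvs_signed (\<Sigma> + \<Sigma>') = fvs_signed \<Sigma> \<union> fvs_signed \<Sigma>'"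
  by (auto simp: fvs_signed_def)

lemma finite_fvs_signed: "finite (fvs_signed \<Sigma>)"
  by (simp add: fvs_signed_def finite_fvs_fm)

lemma fvs_kept_context: "fvs_signed (kept_context m \<phi> \<Sigma>) \<subseteq> fvs_signed \<Sigma>"
  by (auto simp: fvs_signed_def kept_context_def)

lemma map_signed_inst_cong:
  "(\<And>a. a \<in> fvs_fm (formula \<phi>) \<Longrightarrow> \<sigma> a = \<tau> a) \<Longrightarrow> map_signed (inst \<sigma>) \<phi> = map_signed (inst \<tau>) \<phi>"
  by (cases \<phi>) (auto intro: inst_cong)

lemma inst_seq_cong:
  "(\<And>a. a \<in> fvs_signed \<Sigma> \<Longrightarrow> \<sigma> a = \<tau> a) \<Longrightarrow> inst_seq \<sigma> \<Sigma> = inst_seq \<tau> \<Sigma>"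
  by (induction \<Sigma>) (auto intro: map_signed_inst_cong)

lemma inst_seq_FV: "inst_seq FV \<Sigma> = \<Sigma>"
proof -
  have "map_signed (inst FV) \<phi> = \<phi>" for \<phi> :: "('a, 'b) fm signed"
    by (cases \<phi>) (auto simp: inst_FV)
  then show ?thesis by (induction \<Sigma>) simp_all
qed

lemma kept_context_inst: "kept_context m (map_signed (inst \<sigma>) \<phi>) (inst_seq \<sigma> \<Sigma>) = inst_seq \<sigma> (kept_context m \<phi> \<Sigma>)"
proof -
  have "single_succedent m (map_signed (inst \<sigma>) \<phi>) = single_succedent m \<phi>"
    by (cases "(m, \<phi>)" rule: single_succedent.cases) auto
  then show ?thesis by (simp add: kept_context_def filter_mset_image_mset comp_def)
qed

lemma hyps_inst: "hyps (inst_seq \<sigma> \<Sigma>) = inst \<sigma> ` hyps \<Sigma>"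
proof (induction \<Sigma>)
  case (add \<phi> \<Sigma>)
  then show ?case by (cases \<phi>) auto
qed simp

lemma axiomatic_inst:
  assumes "axiomatic m \<Sigma>"
  shows "axiomatic m (inst_seq \<sigma> \<Sigma>)"
  using assms unfolding axiomatic_def
proof (elim disjE exE conjE)
  fix P assume "Right P \<in># \<Sigma>" "follows m (hyps \<Sigma>) P"
  then have "Right (inst \<sigma> P) \<in># inst_seq \<sigma> \<Sigma>" "follows m (hyps (inst_seq \<sigma> \<Sigma>)) (inst \<sigma> P)"
    by (force, simp add: hyps_inst follows_inst)
  then show "(\<exists>P. Right P \<in># inst_seq \<sigma> \<Sigma> \<and> follows m (hyps (inst_seq \<sigma> \<Sigma>)) P) \<or>
    m \<noteq> Minimal \<and> Left Bot \<in># inst_seq \<sigma> \<Sigma>" by blast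
next
  assume "m \<noteq> Minimal" "Left Bot \<in># \<Sigma>"
  moreover from this(2) have "Left Bot \<in># inst_seq \<sigma> \<Sigma>" by force
  ultimately show "(\<exists>P. Right P \<in># inst_seq \<sigma> \<Sigma> \<and> follows m (hyps (inst_seq \<sigma> \<Sigma>)) P) \<or>
    m \<noteq> Minimal \<and> Left Bot \<in># inst_seq \<sigma> \<Sigma>" by blast
qed

lemma inst_update_fresh:
  assumes "b \<notin> fvs_fm A" "\<And>a. is_term L (\<sigma> a)" "is_term L t"
  shows "inst (\<sigma>(b := t)) (A\<langle>x/FV b\<rangle>) = (inst \<sigma> A)\<langle>x/t\<rangle>"
proof -
  have "inst (\<sigma>(b := t)) A = inst \<sigma> A" using assms(1) by (intro inst_cong) auto
  with assms(2,3) show ?thesis by (subst inst_subst[of L]) auto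
qed

text \<open>
  The premisses of an instance of a rule are instances of premisses of that rule.  For the rules
  with one premiss per term, the premiss for \<open>t\<close> comes from the one for a fresh variable \<open>b\<close> by
  sending \<open>b\<close> to \<open>t\<close>; the set \<open>V\<close> is what \<open>b\<close> has to avoid so that the context is not affected.
\<close>

lemma decomp_inst:
  assumes "decomp L m \<phi> Ps" and \<sigma>: "\<And>a. is_term L (\<sigma> a)" and "finite V"
  shows "\<exists>Qs. decomp L m (map_signed (inst \<sigma>) \<phi>) Qs \<and>
    (\<forall>Q\<in>Qs. \<exists>P\<in>Ps. \<exists>\<tau>. (\<forall>a. is_term L (\<tau> a)) \<and> (\<forall>a\<in>V. \<tau> a = \<sigma> a) \<and> Q = inst_seq \<tau> P)"
proof -
  note inst_subst' = inst_subst[of L \<sigma>, OF \<sigma>]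
  have fresh: "\<exists>b. b \<notin> V \<and> b \<notin> fvs_fm A" for A :: "('a, 'b) fm"
    using ex_new_if_finite[of "V \<union> fvs_fm A"] assms(3) by (auto simp: finite_fvs_fm)
  have imm: ?thesis if "decomp L m (map_signed (inst \<sigma>) \<phi>) (inst_seq \<sigma> ` Ps)"
    using that \<sigma> by blast
  show ?thesis
    using assms(1)
  proof cases
    case (LAnd A B)
    then show ?thesis by (intro imm) (auto intro: decomp.intros)
  next
    case (RAnd A B)
    then show ?thesis by (intro imm) (auto intro: decomp.intros)
  next
    case (LOr A B)
    then show ?thesis by (intro imm) (auto intro: decomp.intros)
  next
    case (ROr A B)
    then show ?thesis by (intro imm) (auto intro: decomp.intros)
  next
    case (LImp A B)
    then show ?thesis
      using decomp.LImp[of L m "inst \<sigma> A" "inst \<sigma> B"] by (intro imm) (cases "m = Classical"; simp)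
  next
    case (RImp A B)
    then show ?thesis by (intro imm) (auto intro: decomp.intros)
  next
    case (LAll t x A)
    then show ?thesis
      using decomp.LAll[OF is_term_inst[of L t \<sigma>, OF LAll(3) \<sigma>], of m x "inst \<sigma> A"]
      by (intro imm) (simp add: inst_subst')
  next
    case (REx t x A)
    then show ?thesis
      using decomp.REx[OF is_term_inst[of L t \<sigma>, OF REx(3) \<sigma>], of m x "inst \<sigma> A"]
      by (intro imm) (simp add: inst_subst')
  next
    case (RAll x A)
    obtain b where b: "b \<notin> V" "b \<notin> fvs_fm A" using fresh by blast
    show ?thesis
    proof (intro exI conjI ballI)
      show "decomp L m (map_signed (inst \<sigma>) \<phi>) {{#Right ((inst \<sigma> A)\<langle>x/t\<rangle>)#} |t. is_term L t}"
        by (simp add: RAll decomp.RAll)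
      fix Q assume "Q \<in> {{#Right ((inst \<sigma> A)\<langle>x/t\<rangle>)#} |t. is_term L t}"
      then obtain t where t: "is_term L t" "Q = {#Right ((inst \<sigma> A)\<langle>x/t\<rangle>)#}" by blast
      then have "Q = inst_seq (\<sigma>(b := t)) {#Right (A\<langle>x/FV b\<rangle>)#}"
        using inst_update_fresh[OF b(2) \<sigma>] by simp
      moreover have "{#Right (A\<langle>x/FV b\<rangle>)#} \<in> Ps" by (force simp: RAll is_term_def)
      ultimately show "\<exists>P\<in>Ps. \<exists>\<tau>. (\<forall>a. is_term L (\<tau> a)) \<and> (\<forall>a\<in>V. \<tau> a = \<sigma> a) \<and> Q = inst_seq \<tau> P"
        using t(1) \<sigma> b(1) by (intro bexI exI[of _ "\<sigma>(b := t)"]) auto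
    qed
  next
    case (LEx x A)
    obtain b where b: "b \<notin> V" "b \<notin> fvs_fm A" using fresh by blast
    show ?thesis
    proof (intro exI conjI ballI)
      show "decomp L m (map_signed (inst \<sigma>) \<phi>) {{#Left ((inst \<sigma> A)\<langle>x/t\<rangle>)#} |t. is_term L t}"
        by (simp add: LEx decomp.LEx)
      fix Q assume "Q \<in> {{#Left ((inst \<sigma> A)\<langle>x/t\<rangle>)#} |t. is_term L t}"
      then obtain t where t: "is_term L t" "Q = {#Left ((inst \<sigma> A)\<langle>x/t\<rangle>)#}" by blast
      then have "Q = inst_seq (\<sigma>(b := t)) {#Left (A\<langle>x/FV b\<rangle>)#}"
        using inst_update_fresh[OF b(2) \<sigma>] by simp
      moreover have "{#Left (A\<langle>x/FV b\<rangle>)#} \<in> Ps" by (force simp: LEx is_term_def)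
      ultimately show "\<exists>P\<in>Ps. \<exists>\<tau>. (\<forall>a. is_term L (\<tau> a)) \<and> (\<forall>a\<in>V. \<tau> a = \<sigma> a) \<and> Q = inst_seq \<tau> P"
        using t(1) \<sigma> b(1) by (intro bexI exI[of _ "\<sigma>(b := t)"]) auto
    qed
  qed
qed

lemma prov_inst:
  "prov L m \<Sigma> \<Longrightarrow> (\<And>a. is_term L (\<sigma> a)) \<Longrightarrow> prov L m (inst_seq \<sigma> \<Sigma>)"
proof (induction arbitrary: \<sigma> rule: prov.induct)
  case (axiom \<Sigma>)
  then show ?case by (intro prov.axiom axiomatic_inst)
next
  case (rule \<phi> Ps \<Sigma>)
  obtain Qs where Qs: "decomp L m (map_signed (inst \<sigma>) \<phi>) Qs"
    and Q: "\<And>Q. Q \<in> Qs \<Longrightarrow> \<exists>P\<in>Ps. \<exists>\<tau>. (\<forall>a. is_term L (\<tau> a)) \<and>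
      (\<forall>a\<in>fvs_signed \<Sigma>. \<tau> a = \<sigma> a) \<and> Q = inst_seq \<tau> P"
    using decomp_inst[of L m \<phi> Ps \<sigma>, OF rule.hyps(1) rule.prems finite_fvs_signed[of \<Sigma>]] by blast
  have "prov L m (Q + kept_context m (map_signed (inst \<sigma>) \<phi>) (inst_seq \<sigma> \<Sigma>))" if Q': "Q \<in> Qs" for Q
  proof -
    obtain P \<tau> where P: "P \<in> Ps" and \<tau>: "\<And>a. is_term L (\<tau> a)"
      "\<And>a. a \<in> fvs_signed \<Sigma> \<Longrightarrow> \<tau> a = \<sigma> a" "Q = inst_seq \<tau> P"
      using Q[OF Q'] by blast
    have "prov L m (inst_seq \<tau> P + inst_seq \<tau> (kept_context m \<phi> \<Sigma>))"
      using rule.IH[OF P \<tau>(1)] by simp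
    moreover have "inst_seq \<tau> (kept_context m \<phi> \<Sigma>) = inst_seq \<sigma> (kept_context m \<phi> \<Sigma>)"
      using \<tau>(2) fvs_kept_context by (intro inst_seq_cong) blast
    ultimately show ?thesis using \<tau>(3) by (simp add: kept_context_inst)
  qed
  from prov.rule[OF Qs this] show ?case by simp
qed

text \<open>
  An eigenvariable stands for all terms, which are what the rules of \<open>prov\<close> ask for.
\<close>

lemma prov_generalize:
  assumes "prov L m (add_mset \<phi> \<Sigma>)" and \<phi>: "\<phi> = Left (A\<langle>x/FV a\<rangle>) \<or> \<phi> = Right (A\<langle>x/FV a\<rangle>)"
    and "a \<notin> fvs_fm A" "a \<notin> fvs_signed \<Sigma>" "is_term L t"
  shows "prov L m (add_mset (map_signed (\<lambda>_. A\<langle>x/t\<rangle>) \<phi>) \<Sigma>)"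
proof -
  have FV: "is_term L (FV b)" for b :: nat by (simp add: is_term_def)
  have "prov L m (inst_seq (FV(a := t)) (add_mset \<phi> \<Sigma>))"
    by (rule prov_inst[OF assms(1)]) (simp add: FV assms(5))
  moreover have "inst_seq (FV(a := t)) \<Sigma> = \<Sigma>"
    using assms(4) inst_seq_cong[of \<Sigma> "FV(a := t)" FV] inst_seq_FV[of \<Sigma>] by fastforce
  moreover have "inst (FV(a := t)) (A\<langle>x/FV a\<rangle>) = A\<langle>x/t\<rangle>"
    using inst_update_fresh[OF assms(3) FV assms(5)] by (simp add: inst_FV)
  ultimately show ?thesis using \<phi> by auto
qed


section \<open>The two-sided calculi\<close>

definition signed_of :: "('f, 'p) sequent \<Rightarrow> ('f, 'p) fm signed multiset" where
  "signed_of S = image_mset Left (fst S) + image_mset Right (snd S)"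

lemma signed_of_simps [simp]:
  "signed_of (add_mset A \<Gamma>, \<Delta>) = add_mset (Left A) (signed_of (\<Gamma>, \<Delta>))"
  "signed_of (\<Gamma>, add_mset A \<Delta>) = add_mset (Right A) (signed_of (\<Gamma>, \<Delta>))"
  "signed_of (\<Gamma> + \<Gamma>', \<Delta> + \<Delta>') = signed_of (\<Gamma>, \<Delta>) + signed_of (\<Gamma>', \<Delta>')"
  "hyps (signed_of (\<Gamma>, \<Delta>)) = set_mset \<Gamma>"
  by (auto simp: signed_of_def hyps_def)

lemma filter_signed_of [simp]: "filter_mset is_Left (signed_of (\<Gamma>, \<Delta>)) = signed_of (\<Gamma>, {#})"
  by (simp add: signed_of_def filter_mset_image_mset)

lemma fvs_signed_of: "fvs_signed (signed_of S) = fvs_sequent S"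
  by (auto simp: signed_of_def fvs_signed_def fvs_sequent_def)

lemma is_sequent_simps [simp]:
  "is_sequent L (add_mset A \<Gamma>, \<Delta>) \<longleftrightarrow> is_formula L A \<and> is_sequent L (\<Gamma>, \<Delta>)"
  "is_sequent L (\<Gamma>, add_mset A \<Delta>) \<longleftrightarrow> is_formula L A \<and> is_sequent L (\<Gamma>, \<Delta>)"
  by (auto simp: is_sequent_def)

lemma is_sequent_antecedent: "is_sequent L (\<Gamma>, \<Delta>) \<Longrightarrow> is_sequent L (\<Gamma>, {#})"
  by (auto simp: is_sequent_def)

lemma is_formula_simps [simp]:
  "is_formula L (And A B) \<longleftrightarrow> is_formula L A \<and> is_formula L B"
  "is_formula L (Or A B) \<longleftrightarrow> is_formula L A \<and> is_formula L B"
  "is_formula L (Imp A B) \<longleftrightarrow> is_formula L A \<and> is_formula L B"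
  "is_formula L (Eq t u) \<longleftrightarrow> is_term L t \<and> is_term L u"
  "is_formula L (Pre p ts) \<longleftrightarrow> (p, length ts) \<in> preds L \<and> (\<forall>t \<in> set ts. is_term L t)"
  by (auto simp: is_formula_def is_term_def)

lemma is_formula_instance:
  "is_formula L (All x A) \<Longrightarrow> is_term L t \<Longrightarrow> is_formula L (A\<langle>x/t\<rangle>)"
  "is_formula L (Ex x A) \<Longrightarrow> is_term L t \<Longrightarrow> is_formula L (A\<langle>x/t\<rangle>)"
  by (auto simp: is_formula_def intro: wf_subst)

lemma derivable_is_sequent: "derivable L C S \<Longrightarrow> is_sequent L S"
  by (cases rule: derivable.cases) auto

lemma derivable_mono: "derivable L C S \<Longrightarrow> C \<subseteq> C' \<Longrightarrow> derivable L C' S"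
proof (induction rule: derivable.induct)
  case (derivableI Ss S)
  then show ?case by (auto intro!: derivable.derivableI[of Ss S C'])
qed


section \<open>Equality rules as cuts\<close>

text \<open>
  The rules \<open>Rep1r\<close>, \<open>Rep2r\<close> and \<open>Rep1l_plus\<close>, \<open>Rep2l_plus\<close> differ only in the orientation of their
  equation.  Read upwards, all of them replace \<open>s\<close> by \<open>r\<close>; the equation is \<open>s = r\<close> if \<open>d\<close> holds and \<open>r = s\<close>
  otherwise.
\<close>

definition oriented :: "bool \<Rightarrow> 'f tm \<Rightarrow> 'f tm \<Rightarrow> ('f, 'p) fm" where
  "oriented d s r = (if d then Eq s r else Eq r s)"

definition Rep_right :: "bool \<Rightarrow> ('f, 'p) rule" where
  "Rep_right d = {([(add_mset (oriented d s r) \<Gamma>, add_mset (P\<langle>x/r\<rangle>) \<Delta>)],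
      (add_mset (oriented d s r) \<Gamma>, add_mset (P\<langle>x/s\<rangle>) \<Delta>)) | P x r s \<Gamma> \<Delta>. atomic P}"

definition Rep_left :: "bool \<Rightarrow> ('f, 'p) rule" where
  "Rep_left d =
     {([(add_mset (oriented d s r) (add_mset (P\<langle>x/r\<rangle>) \<Gamma>), \<Delta>)],
       (add_mset (oriented d s r) (add_mset (P\<langle>x/s\<rangle>) \<Gamma>), \<Delta>)) | P x r s \<Gamma> \<Delta>.
         atomic P \<and> \<not> is_equality P} \<union>
     {([(add_mset (oriented d s r) (add_mset (E\<langle>x/s\<rangle>) (add_mset (E\<langle>x/r\<rangle>) \<Gamma>)), \<Delta>)],
       (add_mset (oriented d s r) (add_mset (E\<langle>x/s\<rangle>) \<Gamma>), \<Delta>)) | E x r s \<Gamma> \<Delta>. is_equality E}"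

lemma oriented_flip: "oriented (\<not> d) r s = oriented d s r"
  by (simp add: oriented_def)

lemma Rep_oriented:
  "Rep_right False = Rep1r" "Rep_right True = Rep2r"
  "Rep_left False = Rep1l_plus" "Rep_left True = Rep2l_plus"
  by (simp_all add: Rep_right_def Rep_left_def oriented_def
      Rep1r_def Rep2r_def Rep1l_plus_def Rep2l_plus_def)

text \<open>
  Instantiated below with the axiomatic sequents and with the sequents provable in \<open>prov\<close>.
\<close>

locale entailment =
  fixes m :: logic and K :: "('f, 'p) fm signed multiset \<Rightarrow> bool"
  assumes axiom: "axiomatic m \<Sigma> \<Longrightarrow> K \<Sigma>"
    and contr: "K (\<Delta> + \<Delta> + \<Gamma>) \<Longrightarrow> K (\<Delta> + \<Gamma>)"
    and cut: "K (add_mset (Right A) \<Gamma>) \<Longrightarrow> K (add_mset (Left A) \<Lambda>) \<Longrightarrow> K (\<Gamma> + \<Lambda>)"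
begin

lemma replacement_axiom:
  assumes "atomic P" "e = oriented d s r"
  shows "K {#Left e, Left (P\<langle>x/r\<rangle>), Right (P\<langle>x/s\<rangle>)#}"
proof (rule axiom)
  have "equates {e} r s" using assms(2) by (auto simp: oriented_def intro: equates.base equates.sym)
  from follows_replacement[OF assms(1) this, of m x]
  show "axiomatic m {#Left e, Left (P\<langle>x/r\<rangle>), Right (P\<langle>x/s\<rangle>)#}"
    by (auto simp: axiomatic_def insert_commute)
qed

lemma replacement_right:
  assumes "atomic P" "e = oriented d s r"
    and "K (add_mset (Left e) (add_mset (Right (P\<langle>x/r\<rangle>)) \<Sigma>))"
  shows "K (add_mset (Left e) (add_mset (Right (P\<langle>x/s\<rangle>)) \<Sigma>))"
  using cut[of "P\<langle>x/r\<rangle>" "add_mset (Left e) \<Sigma>" "{#Left e, Right (P\<langle>x/s\<rangle>)#}"]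
    replacement_axiom[OF assms(1,2), of x] assms(3)
    contr[of "{#Left e#}" "add_mset (Right (P\<langle>x/s\<rangle>)) \<Sigma>"]
  by (simp add: add_mset_commute)

lemma replacement_left:
  assumes "atomic P" "e = oriented d s r"
    and "K (add_mset (Left e) (add_mset (Left (P\<langle>x/r\<rangle>)) \<Sigma>))"
  shows "K (add_mset (Left e) (add_mset (Left (P\<langle>x/s\<rangle>)) \<Sigma>))"
  using cut[of "P\<langle>x/r\<rangle>" "{#Left e, Left (P\<langle>x/s\<rangle>)#}" "add_mset (Left e) \<Sigma>"]
    replacement_axiom[OF assms(1), of e "\<not> d" r s x] assms(2,3)
    contr[of "{#Left e#}" "add_mset (Left (P\<langle>x/s\<rangle>)) \<Sigma>"]
  by (simp add: add_mset_commute oriented_flip)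

lemma replacement_left_keep:
  assumes "atomic P" "e = oriented d s r"
    and "K (add_mset (Left e) (add_mset (Left (P\<langle>x/s\<rangle>)) (add_mset (Left (P\<langle>x/r\<rangle>)) \<Sigma>)))"
  shows "K (add_mset (Left e) (add_mset (Left (P\<langle>x/s\<rangle>)) \<Sigma>))"
  using replacement_left[OF assms(1,2), of x "add_mset (Left (P\<langle>x/s\<rangle>)) \<Sigma>"] assms(3)
    contr[of "{#Left (P\<langle>x/s\<rangle>)#}" "add_mset (Left e) \<Sigma>"]
  by (simp add: add_mset_commute)

lemma initial_sequents_sound:
  assumes "(Ss, S) \<in> initial_sequents m"
  shows "K (signed_of S)"
proof -
  from assms consider (hyp) P \<Gamma> \<Delta> where "S = (add_mset P \<Gamma>, add_mset P \<Delta>)" "axiom_formula m P"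
    | (bot) \<Gamma> \<Delta> where "m \<noteq> Minimal" "S = (add_mset Bot \<Gamma>, \<Delta>)"
    by (cases m) (auto simp: initial_def L_bot_def initial_bot_def axiom_formula_def)
  then have "axiomatic m (signed_of S)"
  proof cases
    case hyp
    then have "follows m (insert P (set_mset \<Gamma>)) P" by (simp add: follows_hypothesis)
    with hyp show ?thesis by (auto simp: axiomatic_def)
  next
    case bot
    then show ?thesis by (simp add: axiomatic_def)
  qed
  then show ?thesis by (rule axiom)
qed

text \<open>
  A replacement on the right is a cut of the premiss with \<open>replacement_axiom\<close>; a replacement on the
  left is the same cut on the other side, with \<open>r\<close> and \<open>s\<close> exchanged.  The duplicate copies of the
  equation, and of the formula kept by the left rules for equalities, are contracted.
\<close>

lemma equality_rules_sound:
  assumes R: "(Ss, S) \<in> Ref \<union> Rep_right d \<union> Rep_left d"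
    and prems: "\<And>S'. S' \<in> set Ss \<Longrightarrow> K (signed_of S')"
  shows "K (signed_of S)"
proof -
  have eq: "atomic P" if "is_equality P" for P :: "('f, 'p) fm" using that by (simp add: atomic_def)
  from R consider "(Ss, S) \<in> Ref" | "(Ss, S) \<in> Rep_right d" | "(Ss, S) \<in> Rep_left d"
    by blast
  then show ?thesis
  proof cases
    case 1
    then obtain t \<Gamma> \<Delta> where "S = (\<Gamma>, add_mset (Eq t t) \<Delta>)" by (auto simp: Ref_def)
    then show ?thesis by (auto intro!: axiom follows.Eq equates.refl simp: axiomatic_def)
  next
    case 2
    then show ?thesis
      using prems replacement_right[OF _ HOL.refl, of _ d]
      by (auto simp: Rep_right_def add_mset_commute)
  next
    case 3
    then show ?thesis
      unfolding Rep_left_def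
    proof (elim UnE CollectE exE conjE)
      fix P x r s \<Gamma> \<Delta>
      assume "(Ss, S) = ([(add_mset (oriented d s r) (add_mset (P\<langle>x/r\<rangle>) \<Gamma>), \<Delta>)],
        (add_mset (oriented d s r) (add_mset (P\<langle>x/s\<rangle>) \<Gamma>), \<Delta>))" "atomic P"
      then show ?thesis
        using prems replacement_left[of P _ d s r x "signed_of (\<Gamma>, \<Delta>)"] by simp
    next
      fix E x r s \<Gamma> \<Delta>
      assume "(Ss, S) = ([(add_mset (oriented d s r)
          (add_mset (E\<langle>x/s\<rangle>) (add_mset (E\<langle>x/r\<rangle>) \<Gamma>)), \<Delta>)],
        (add_mset (oriented d s r) (add_mset (E\<langle>x/s\<rangle>) \<Gamma>), \<Delta>))" "is_equality E"
      then show ?thesis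
        using prems replacement_left_keep[of E _ d s r x "signed_of (\<Gamma>, \<Delta>)"] eq by simp
    qed
  qed
qed

end

interpretation axiomatic_entailment: entailment m "axiomatic m" for m
proof
  fix A \<Gamma> \<Lambda>
  assume *: "axiomatic m (add_mset (Right A) \<Gamma>)" "axiomatic m (add_mset (Left A) \<Lambda>)"
  then consider "follows m (hyps \<Gamma>) A" | "axiomatic m \<Gamma>" by (auto simp: axiomatic_def)
  then show "axiomatic m (\<Gamma> + \<Lambda>)"
  proof cases
    case 1
    then show ?thesis using *(2) by (rule axiomatic_cut)
  next
    case 2
    then show ?thesis by (rule axiomatic_mono) auto
  qed
qed (auto elim!: axiomatic_mono)

interpretation prov_entailment: entailment m "prov L m" for L m
  by standard (auto intro: prov.axiom contraction cut)


abbreviation oriented_rules :: "bool \<Rightarrow> ('f, 'p) rule set" where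
  "oriented_rules d \<equiv> {Ref, Rep_left d, Rep_right d}"


section \<open>Derivations in G3 and in the signed calculus\<close>

lemma prov_ruleI:
  "decomp L m \<phi> Ps \<Longrightarrow> \<forall>P\<in>Ps. prov L m (P + kept_context m \<phi> \<Sigma>) \<Longrightarrow> prov L m (add_mset \<phi> \<Sigma>)"
  by (auto intro: prov.rule)

lemma kept_context_signed_of:
  "kept_context m \<phi> (signed_of (\<Gamma>, \<Delta>)) = signed_of (\<Gamma>, if single_succedent m \<phi> then {#} else \<Delta>)"
  by (simp add: kept_context_def)

lemma prov_fresh_All:
  assumes "prov L m (add_mset (Right (A\<langle>x/FV a\<rangle>)) (kept_context m (Right (All x A)) \<Sigma>))"
    and "a \<notin> fvs_fm A" "a \<notin> fvs_signed \<Sigma>"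
  shows "prov L m (add_mset (Right (All x A)) \<Sigma>)"
proof -
  have "a \<notin> fvs_signed (kept_context m (Right (All x A)) \<Sigma>)" using assms(3) fvs_kept_context by blast
  then show ?thesis
    using prov_generalize[OF assms(1) _ assms(2), of x]
    by (intro prov_ruleI[OF decomp.RAll]) auto
qed

lemma prov_fresh_Ex:
  assumes "prov L m (add_mset (Left (A\<langle>x/FV a\<rangle>)) \<Sigma>)"
    and "a \<notin> fvs_fm A" "a \<notin> fvs_signed \<Sigma>"
  shows "prov L m (add_mset (Left (Ex x A)) \<Sigma>)"
  using prov_generalize[OF assms(1) _ assms(2), of x] assms(3)
  by (intro prov_ruleI[OF decomp.LEx]) auto

lemma logical_rules_sound:
  assumes "(Ss, S) \<in> logical_rules L m"
    and prems: "\<forall>S' \<in> set Ss. prov L m (signed_of S')"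
  shows "prov L m (signed_of S)"
proof -
  from assms(1) consider "(Ss, S) \<in> L_and" | "(Ss, S) \<in> R_and" | "(Ss, S) \<in> L_or" | "(Ss, S) \<in> R_or"
    | "(Ss, S) \<in> L_imp" "m = Classical" | "(Ss, S) \<in> R_imp" "m = Classical"
    | "(Ss, S) \<in> Li_imp" "m \<noteq> Classical" | "(Ss, S) \<in> Ri_imp" "m \<noteq> Classical"
    | "(Ss, S) \<in> L_all L" | "(Ss, S) \<in> R_all" "m = Classical" | "(Ss, S) \<in> Ri_all" "m \<noteq> Classical"
    | "(Ss, S) \<in> L_ex" | "(Ss, S) \<in> R_ex L"
    by (cases m) auto
  then show ?thesis
  proof cases
    case 1
    then show ?thesis using prems
      by (auto simp: L_and_def intro!: prov_ruleI[OF decomp.LAnd])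
  next
    case 2
    then show ?thesis using prems
      by (auto simp: R_and_def intro!: prov_ruleI[OF decomp.RAnd])
  next
    case 3
    then show ?thesis using prems
      by (auto simp: L_or_def intro!: prov_ruleI[OF decomp.LOr])
  next
    case 4
    then show ?thesis using prems
      by (auto simp: R_or_def intro!: prov_ruleI[OF decomp.ROr])
  next
    case 5
    then show ?thesis using prems
      by (auto simp: L_imp_def intro!: prov_ruleI[OF decomp.LImp])
  next
    case 6
    then show ?thesis using prems
      by (auto simp: R_imp_def add_mset_commute intro!: prov_ruleI[OF decomp.RImp])
  next
    case 7
    then show ?thesis using prems
      by (auto simp: Li_imp_def add_mset_commute intro!: prov_ruleI[OF decomp.LImp])
  next
    case 8
    then show ?thesis using prems
      by (auto simp: Ri_imp_def kept_context_signed_of add_mset_commute intro!: prov_ruleI[OF decomp.RImp])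
  next
    case 9
    then show ?thesis using prems
      by (auto simp: L_all_def intro!: prov_ruleI[OF decomp.LAll])
  next
    case 10
    then show ?thesis using prems
      by (auto simp: R_all_def fvs_signed_of[symmetric] intro!: prov_fresh_All)
  next
    case 11
    then show ?thesis using prems
      by (auto simp: Ri_all_def fvs_signed_of[symmetric] kept_context_signed_of intro!: prov_fresh_All)
  next
    case 12
    then show ?thesis using prems
      by (auto simp: L_ex_def fvs_signed_of[symmetric] intro!: prov_fresh_Ex)
  next
    case 13
    then show ?thesis using prems
      by (auto simp: R_ex_def add_mset_commute intro!: prov_ruleI[OF decomp.REx])
  qed
qed

lemma derivable_imp_axiomatic:
  assumes "derivable L (calculus_of m \<R>) S" "\<Union>\<R> \<subseteq> (\<Union>d. \<Union>(oriented_rules d))"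
  shows "axiomatic m (signed_of S)"
  using assms(1)
proof (induction rule: derivable.induct)
  case (derivableI Ss S)
  then consider "(Ss, S) \<in> initial_sequents m" | d where "(Ss, S) \<in> Ref \<union> Rep_right d \<union> Rep_left d"
    using assms(2) unfolding calculus_of_def by blast
  then show ?case
    by cases (blast intro: axiomatic_entailment.initial_sequents_sound,
        use axiomatic_entailment.equality_rules_sound derivableI.IH in blast)
qed

lemma derivable_imp_prov:
  assumes "derivable L (G3_ext L m (oriented_rules d)) S"
  shows "prov L m (signed_of S)"
  using assms
proof (induction rule: derivable.induct)
  case (derivableI Ss S)
  then consider "(Ss, S) \<in> initial_sequents m" | "(Ss, S) \<in> logical_rules L m"
    | "(Ss, S) \<in> Ref \<union> Rep_right d \<union> Rep_left d"
    by (auto simp: G3_ext_def G3_def)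
  then show ?case
    by cases (blast intro: prov_entailment.initial_sequents_sound,
        use logical_rules_sound derivableI.IH in blast,
        use prov_entailment.equality_rules_sound derivableI.IH in blast)
qed

lemma signed_of_LeftE:
  assumes "add_mset (Left A) \<Sigma> = signed_of S"
  obtains \<Gamma> \<Delta> where "S = (add_mset A \<Gamma>, \<Delta>)" "\<Sigma> = signed_of (\<Gamma>, \<Delta>)"
proof -
  have "Left A \<in># signed_of S" by (simp flip: assms)
  then have "A \<in># fst S" by (auto simp: signed_of_def)
  then obtain \<Gamma> where "fst S = add_mset A \<Gamma>" by (auto dest: multi_member_split)
  then have "S = (add_mset A \<Gamma>, snd S)" by (simp add: prod_eq_iff)
  moreover from this assms have "\<Sigma> = signed_of (\<Gamma>, snd S)"
    by (metis add_mset_add_mset_same_iff signed_of_simps(1))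
  ultimately show thesis by (rule that)
qed

lemma signed_of_RightE:
  assumes "add_mset (Right A) \<Sigma> = signed_of S"
  obtains \<Gamma> \<Delta> where "S = (\<Gamma>, add_mset A \<Delta>)" "\<Sigma> = signed_of (\<Gamma>, \<Delta>)"
proof -
  have "Right A \<in># signed_of S" by (simp flip: assms)
  then have "A \<in># snd S" by (auto simp: signed_of_def)
  then obtain \<Delta> where "snd S = add_mset A \<Delta>" by (auto dest: multi_member_split)
  then have "S = (fst S, add_mset A \<Delta>)" by (simp add: prod_eq_iff)
  moreover from this assms have "\<Sigma> = signed_of (fst S, \<Delta>)"
    by (metis add_mset_add_mset_same_iff signed_of_simps(2))
  ultimately show thesis by (rule that)
qed

lemma fresh_variable: "\<exists>a. a \<notin> fvs_sequent S"
  using ex_new_if_finite[OF infinite_UNIV_nat finite_fvs_signed[of "signed_of S"]]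
  by (simp add: fvs_signed_of)

text \<open>
  The rules of the two calculi match one by one, and the premisses of a rule whose conclusion is a
  sequent of the language are again such sequents.  From the premisses for all terms only the one for
  a fresh variable is used.
\<close>

lemma prov_imp_derivable:
  assumes axiom: "\<And>S. is_sequent L S \<Longrightarrow> axiomatic m (signed_of S) \<Longrightarrow> derivable L C S"
    and C: "logical_rules L m \<subseteq> C"
    and "prov L m (signed_of S)" "is_sequent L S"
  shows "derivable L C S"
  using assms(3,4)
proof (induction "signed_of S" arbitrary: S rule: prov.induct)
  case axiom
  then show ?case by (intro assms(1))
next
  case (rule \<phi> Ps \<Sigma>)
  have "\<exists>Ss. (Ss, S) \<in> logical_rules L m \<and>
      (\<forall>S'\<in>set Ss. is_sequent L S' \<and> (\<exists>P\<in>Ps. P + kept_context m \<phi> \<Sigma> = signed_of S'))"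
    using rule.hyps(1)
  proof cases
    case (LAnd A B)
    with rule.hyps(4) obtain \<Gamma> \<Delta> where *: "S = (add_mset (And A B) \<Gamma>, \<Delta>)" "\<Sigma> = signed_of (\<Gamma>, \<Delta>)"
      by (auto elim: signed_of_LeftE)
    have "([(add_mset A (add_mset B \<Gamma>), \<Delta>)], S) \<in> logical_rules L m"
      using * by (cases m) (auto simp: L_and_def)
    then show ?thesis using * rule.prems LAnd by (intro exI conjI) auto
  next
    case (RAnd A B)
    with rule.hyps(4) obtain \<Gamma> \<Delta> where *: "S = (\<Gamma>, add_mset (And A B) \<Delta>)" "\<Sigma> = signed_of (\<Gamma>, \<Delta>)"
      by (auto elim: signed_of_RightE)
    have "([(\<Gamma>, add_mset A \<Delta>), (\<Gamma>, add_mset B \<Delta>)], S) \<in> logical_rules L m"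
      using * by (cases m) (auto simp: R_and_def)
    then show ?thesis using * rule.prems RAnd by (intro exI conjI) auto
  next
    case (LOr A B)
    with rule.hyps(4) obtain \<Gamma> \<Delta> where *: "S = (add_mset (Or A B) \<Gamma>, \<Delta>)" "\<Sigma> = signed_of (\<Gamma>, \<Delta>)"
      by (auto elim: signed_of_LeftE)
    have "([(add_mset A \<Gamma>, \<Delta>), (add_mset B \<Gamma>, \<Delta>)], S) \<in> logical_rules L m"
      using * by (cases m) (auto simp: L_or_def)
    then show ?thesis using * rule.prems LOr by (intro exI conjI) auto
  next
    case (ROr A B)
    with rule.hyps(4) obtain \<Gamma> \<Delta> where *: "S = (\<Gamma>, add_mset (Or A B) \<Delta>)" "\<Sigma> = signed_of (\<Gamma>, \<Delta>)"
      by (auto elim: signed_of_RightE)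
    have "([(\<Gamma>, add_mset A (add_mset B \<Delta>))], S) \<in> logical_rules L m"
      using * by (cases m) (auto simp: R_or_def)
    then show ?thesis using * rule.prems ROr by (intro exI conjI) auto
  next
    case (LImp A B)
    with rule.hyps(4) obtain \<Gamma> \<Delta> where *: "S = (add_mset (Imp A B) \<Gamma>, \<Delta>)" "\<Sigma> = signed_of (\<Gamma>, \<Delta>)"
      by (auto elim: signed_of_LeftE)
    have "([(if m = Classical then \<Gamma> else add_mset (Imp A B) \<Gamma>, add_mset A \<Delta>), (add_mset B \<Gamma>, \<Delta>)], S)
        \<in> logical_rules L m"
      using * by (cases m) (auto simp: L_imp_def Li_imp_def)
    then show ?thesis using * rule.prems LImp
      by (intro exI conjI) (auto simp: add_mset_commute split: if_splits)
  next
    case (RImp A B)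
    with rule.hyps(4) obtain \<Gamma> \<Delta> where *: "S = (\<Gamma>, add_mset (Imp A B) \<Delta>)" "\<Sigma> = signed_of (\<Gamma>, \<Delta>)"
      by (auto elim: signed_of_RightE)
    have "([(add_mset A \<Gamma>, add_mset B (if m = Classical then \<Delta> else {#}))], S) \<in> logical_rules L m"
      using * by (cases m) (auto simp: R_imp_def Ri_imp_def)
    then show ?thesis using * rule.prems RImp is_sequent_antecedent[of L \<Gamma> \<Delta>]
      by (intro exI conjI) (auto simp: add_mset_commute kept_context_signed_of)
  next
    case (LAll t x A)
    with rule.hyps(4) obtain \<Gamma> \<Delta> where *: "S = (add_mset (All x A) \<Gamma>, \<Delta>)" "\<Sigma> = signed_of (\<Gamma>, \<Delta>)"
      by (auto elim: signed_of_LeftE)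
    have "([(add_mset (A\<langle>x/t\<rangle>) (add_mset (All x A) \<Gamma>), \<Delta>)], S) \<in> logical_rules L m"
      using * LAll by (cases m) (auto simp: L_all_def)
    then show ?thesis using * rule.prems LAll by (intro exI conjI) (auto intro: is_formula_instance)
  next
    case (REx t x A)
    with rule.hyps(4) obtain \<Gamma> \<Delta> where *: "S = (\<Gamma>, add_mset (Ex x A) \<Delta>)" "\<Sigma> = signed_of (\<Gamma>, \<Delta>)"
      by (auto elim: signed_of_RightE)
    have "([(\<Gamma>, add_mset (Ex x A) (add_mset (A\<langle>x/t\<rangle>) \<Delta>))], S) \<in> logical_rules L m"
      using * REx by (cases m) (auto simp: R_ex_def)
    then show ?thesis using * rule.prems REx
      by (intro exI conjI) (auto simp: add_mset_commute intro: is_formula_instance)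
  next
    case (RAll x A)
    with rule.hyps(4) obtain \<Gamma> \<Delta> where *: "S = (\<Gamma>, add_mset (All x A) \<Delta>)" "\<Sigma> = signed_of (\<Gamma>, \<Delta>)"
      by (auto elim: signed_of_RightE)
    obtain a where a: "a \<notin> fvs_sequent S" using fresh_variable by blast
    have FV: "is_term L (FV a)" by (simp add: is_term_def)
    have "([(\<Gamma>, add_mset (A\<langle>x/FV a\<rangle>) (if m = Classical then \<Delta> else {#}))], S) \<in> logical_rules L m"
      using * a by (cases m) (auto simp: R_all_def Ri_all_def)
    then show ?thesis using * rule.prems RAll is_sequent_antecedent[of L \<Gamma> \<Delta>] FV
      by (intro exI conjI) (auto simp: kept_context_signed_of intro: is_formula_instance)
  next
    case (LEx x A)
    with rule.hyps(4) obtain \<Gamma> \<Delta> where *: "S = (add_mset (Ex x A) \<Gamma>, \<Delta>)" "\<Sigma> = signed_of (\<Gamma>, \<Delta>)"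
      by (auto elim: signed_of_LeftE)
    obtain a where a: "a \<notin> fvs_sequent S" using fresh_variable by blast
    have FV: "is_term L (FV a)" by (simp add: is_term_def)
    have "([(add_mset (A\<langle>x/FV a\<rangle>) \<Gamma>, \<Delta>)], S) \<in> logical_rules L m"
      using * a by (cases m) (auto simp: L_ex_def)
    then show ?thesis using * rule.prems LEx FV
      by (intro exI conjI) (auto intro: is_formula_instance)
  qed
  then obtain Ss where "(Ss, S) \<in> logical_rules L m"
    and Ss: "\<And>S'. S' \<in> set Ss \<Longrightarrow> is_sequent L S' \<and> (\<exists>P\<in>Ps. P + kept_context m \<phi> \<Sigma> = signed_of S')"
    by blast
  then have "(Ss, S) \<in> C" using C by blast
  then show ?case using rule.prems
  proof (rule derivable.derivableI)
    fix S' assume "S' \<in> set Ss"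
    then show "derivable L C S'" using Ss rule.hyps(3) by blast
  qed
qed

lemma structural_rules_admissible:
  assumes C: "\<And>S. derivable L C S \<longleftrightarrow> is_sequent L S \<and> prov L m (signed_of S)"
    and R: "R \<in> structural_rules"
  shows "admissible L C R"
  unfolding admissible_def
proof (clarify)
  fix Ss \<Gamma> \<Delta>
  assume inst: "(Ss, \<Gamma>, \<Delta>) \<in> R" and "is_sequent L (\<Gamma>, \<Delta>)" and "\<forall>S'\<in>set Ss. derivable L C S'"
  then have prems: "\<And>S'. S' \<in> set Ss \<Longrightarrow> prov L m (signed_of S')" by (simp add: C)
  from R inst consider "(Ss, \<Gamma>, \<Delta>) \<in> L_weakening" | "(Ss, \<Gamma>, \<Delta>) \<in> R_weakening"
    | "(Ss, \<Gamma>, \<Delta>) \<in> L_contraction" | "(Ss, \<Gamma>, \<Delta>) \<in> R_contraction" | "(Ss, \<Gamma>, \<Delta>) \<in> Cut"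
    by (auto simp: structural_rules_def)
  then have "prov L m (signed_of (\<Gamma>, \<Delta>))"
  proof cases
    case 1
    then show ?thesis using prems by (auto simp: L_weakening_def intro: weakening_subset)
  next
    case 2
    then show ?thesis using prems by (auto simp: R_weakening_def intro: weakening_subset)
  next
    case 3
    then show ?thesis using prems by (auto simp: L_contraction_def intro: contraction_formula)
  next
    case 4
    then show ?thesis using prems by (auto simp: R_contraction_def intro: contraction_formula)
  next
    case 5
    then obtain A \<Gamma>1 \<Gamma>2 \<Delta>1 \<Delta>2 where "Ss = [(\<Gamma>1, add_mset A \<Delta>1), (add_mset A \<Gamma>2, \<Delta>2)]"
      "\<Gamma> = \<Gamma>1 + \<Gamma>2" "\<Delta> = \<Delta>1 + \<Delta>2"
      by (auto simp: Cut_def)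
    then show ?thesis
      using prems[of "(\<Gamma>1, add_mset A \<Delta>1)"] prems[of "(add_mset A \<Gamma>2, \<Delta>2)"]
        cut[of L m A "signed_of (\<Gamma>1, \<Delta>1)" "signed_of (\<Gamma>2, \<Delta>2)"] by simp
  qed
  with \<open>is_sequent L (\<Gamma>, \<Delta>)\<close> show "derivable L C (\<Gamma>, \<Delta>)" by (simp add: C)
qed


section \<open>Rewriting with equations\<close>

inductive rw :: "('f tm \<times> 'f tm) set \<Rightarrow> 'f tm \<Rightarrow> 'f tm \<Rightarrow> bool" for E where
  root: "(l, r) \<in> E \<Longrightarrow> rw E l r"
| arg: "i < length ts \<Longrightarrow> rw E (ts ! i) u \<Longrightarrow> rw E (Fn f ts) (Fn f (ts[i := u]))"

inductive rw_atom :: "('f tm \<times> 'f tm) set \<Rightarrow> ('f, 'p) fm \<Rightarrow> ('f, 'p) fm \<Rightarrow> bool" for E where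
  Eq_left: "rw E t t' \<Longrightarrow> rw_atom E (Eq t u) (Eq t' u)"
| Eq_right: "rw E u u' \<Longrightarrow> rw_atom E (Eq t u) (Eq t u')"
| Pre: "i < length ts \<Longrightarrow> rw E (ts ! i) u \<Longrightarrow> rw_atom E (Pre p ts) (Pre p (ts[i := u]))"

lemma rw_single: "rw E t u \<Longrightarrow> \<exists>l r. (l, r) \<in> E \<and> rw {(l, r)} t u"
proof (induction rule: rw.induct)
  case (root l r)
  then show ?case by (auto intro!: rw.root)
next
  case (arg i ts u f)
  then show ?case by (auto intro!: rw.arg)
qed

text \<open>
  A step inside a proper subterm of \<open>l\<close> cannot use the equation for \<open>l\<close> itself.  Hence an equation
  never has to be rewritten by its own copy, and completion can ask for two different equations.
\<close>

lemma rw_single_size: "rw {(l, r)} t u \<Longrightarrow> t = l \<and> u = r \<or> size l < size t"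
proof (induction rule: rw.induct)
  case (arg i ts u f)
  then have "size l \<le> size (ts ! i)" by auto
  also have "\<dots> \<le> size_list size ts"
    using arg.hyps(1) by (intro size_list_estimation'[of "ts ! i"]) auto
  finally show ?case by simp
qed simp

lemma rw_is_term:
  "rw E t u \<Longrightarrow> (\<And>l r. (l, r) \<in> E \<Longrightarrow> is_term L r) \<Longrightarrow> is_term L t \<Longrightarrow> is_term L u"
proof (induction rule: rw.induct)
  case (arg i ts u f)
  then show ?case
    using set_update_subset_insert[of ts i u] by (auto simp: is_term_def)
qed auto

text \<open>
  Turns a rewrite step into the form used in the replacement rules, where the bound variable \<open>x\<close> marks
  the position.  As the other subterms are terms of the language, they do not contain \<open>x\<close>.
\<close>

lemma rw_context:
  "rw E t u \<Longrightarrow> is_term L t \<Longrightarrow> \<exists>C l r. (l, r) \<in> E \<and> t = subst_tm C x l \<and> u = subst_tm C x r"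
proof (induction rule: rw.induct)
  case (root l r)
  then show ?case by (intro exI[of _ "BV x"] exI[of _ l] exI[of _ r]) auto
next
  case (arg i ts u f)
  have closed: "subst_tm t x s = t" if "t \<in> set ts" for t s
    using arg.prems that by (auto simp: is_term_def intro: subst_tm_closed)
  have "is_term L (ts ! i)" using arg.hyps(1) arg.prems by (simp add: is_term_def)
  with arg.IH obtain C l r where C: "(l, r) \<in> E" "ts ! i = subst_tm C x l" "u = subst_tm C x r"
    by blast
  have "subst_tm (Fn f (ts[i := C])) x s = Fn f (ts[i := subst_tm C x s])" for s
    by (simp add: map_update map_idI closed)
  then have "subst_tm (Fn f (ts[i := C])) x l = Fn f ts"
    "subst_tm (Fn f (ts[i := C])) x r = Fn f (ts[i := u])"
    using C(2,3) by (metis list_update_id, metis)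
  with C(1) show ?case by metis
qed

lemma rw_atom_is_formula:
  "rw_atom E A B \<Longrightarrow> (\<And>l r. (l, r) \<in> E \<Longrightarrow> is_term L r) \<Longrightarrow> is_formula L A \<Longrightarrow> is_formula L B"
proof (induction rule: rw_atom.induct)
  case (Pre i ts u p)
  then have "is_term L u" by (auto intro: rw_is_term)
  with Pre show ?case
    using set_update_subset_insert[of ts i u] by auto
qed (auto intro: rw_is_term)

lemma rw_atom_context:
  assumes "rw_atom E A B" "is_formula L A"
  obtains P l r where "(l, r) \<in> E" "atomic P" "is_equality P \<longleftrightarrow> is_equality A"
    "A = P\<langle>x/l\<rangle>" "B = P\<langle>x/r\<rangle>"
  using assms
proof cases
  case (Eq_left t t' u)
  then obtain C l r where C: "(l, r) \<in> E" "t = subst_tm C x l" "t' = subst_tm C x r"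
    using rw_context[of E t t' L x] assms(2) by auto
  have "subst_tm u x s = u" for s
    using Eq_left assms(2) by (auto simp: is_term_def intro: subst_tm_closed)
  with Eq_left C show thesis
    by (intro that[of l r "Eq C u"]) (auto simp: atomic_def is_equality_def)
next
  case (Eq_right u u' t)
  then obtain C l r where C: "(l, r) \<in> E" "u = subst_tm C x l" "u' = subst_tm C x r"
    using rw_context[of E u u' L x] assms(2) by auto
  have "subst_tm t x s = t" for s
    using Eq_right assms(2) by (auto simp: is_term_def intro: subst_tm_closed)
  with Eq_right C show thesis
    by (intro that[of l r "Eq t C"]) (auto simp: atomic_def is_equality_def)
next
  case (Pre i ts u p)
  have closed: "subst_tm t x s = t" if "t \<in> set ts" for t s
    using Pre assms(2) that by (auto simp: is_term_def intro: subst_tm_closed)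
  obtain C l r where C: "(l, r) \<in> E" "ts ! i = subst_tm C x l" "u = subst_tm C x r"
    using rw_context[of E "ts ! i" u L x] Pre assms(2) by auto
  let ?P = "Pre p (ts[i := C])"
  have "?P\<langle>x/s\<rangle> = Pre p (ts[i := subst_tm C x s])" for s
    by (simp add: map_update map_idI closed)
  then have "A = ?P\<langle>x/l\<rangle>" "B = ?P\<langle>x/r\<rangle>"
    using C(2,3) Pre(1,2) by (metis list_update_id, metis)
  then show thesis
    using C(1) Pre(1) by (intro that[of l r ?P]) (simp_all add: atomic_def is_equality_def)
qed

definition step_in_list :: "('a \<Rightarrow> 'a \<Rightarrow> bool) \<Rightarrow> 'a list \<Rightarrow> 'a list \<Rightarrow> bool" where
  "step_in_list R xs ys \<longleftrightarrow> (\<exists>i < length xs. \<exists>y. R (xs ! i) y \<and> ys = xs[i := y])"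

lemma step_in_list_rtranclp:
  "list_all2 R\<^sup>*\<^sup>* xs ys \<Longrightarrow> (step_in_list R)\<^sup>*\<^sup>* xs ys"
proof (induction rule: list_all2_induct)
  case (Cons x xs y ys)
  from Cons.hyps(1) have "(step_in_list R)\<^sup>*\<^sup>* (x # xs) (y # xs)"
  proof (induction rule: rtranclp_induct)
    case (step y z)
    then have "step_in_list R (y # xs) (z # xs)" by (force simp: step_in_list_def)
    with step.IH show ?case by simp
  qed simp
  also from Cons.IH have "(step_in_list R)\<^sup>*\<^sup>* (y # xs) (y # ys)"
  proof (induction rule: rtranclp_induct)
    case (step us vs)
    then obtain i v where "i < length us" "R (us ! i) v" "vs = us[i := v]"
      by (auto simp: step_in_list_def)
    then have "step_in_list R (y # us) (y # vs)"
      unfolding step_in_list_def by (intro exI[of _ "Suc i"]) auto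
    with step.IH show ?case by simp
  qed simp
  finally show ?case .
qed simp

lemma rw_args:
  assumes "list_all2 (rw E)\<^sup>*\<^sup>* ts us"
  shows "(rw E)\<^sup>*\<^sup>* (Fn f ts) (Fn f us)"
  using step_in_list_rtranclp[OF assms]
proof (induction rule: rtranclp_induct)
  case (step us vs)
  then have "rw E (Fn f us) (Fn f vs)" by (auto simp: step_in_list_def intro: rw.arg)
  with step.IH show ?case by simp
qed simp

lemma rw_atom_Pre:
  assumes "list_all2 (rw E)\<^sup>*\<^sup>* ts us"
  shows "(rw_atom E)\<^sup>*\<^sup>* (Pre p ts) (Pre p us)"
  using step_in_list_rtranclp[OF assms]
proof (induction rule: rtranclp_induct)
  case (step us vs)
  then have "rw_atom E (Pre p us) (Pre p vs)" by (auto simp: step_in_list_def intro: rw_atom.Pre)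
  with step.IH show ?case by simp
qed simp

lemma rw_atom_Eq:
  assumes "(rw E)\<^sup>*\<^sup>* t t'" "(rw E)\<^sup>*\<^sup>* u u'"
  shows "(rw_atom E)\<^sup>*\<^sup>* (Eq t u) (Eq t' u')"
proof -
  from assms(1) have "(rw_atom E)\<^sup>*\<^sup>* (Eq t u) (Eq t' u)"
    by (induction rule: rtranclp_induct) (auto intro: rtranclp.rtrancl_into_rtrancl rw_atom.intros)
  also from assms(2) have "(rw_atom E)\<^sup>*\<^sup>* (Eq t' u) (Eq t' u')"
    by (induction rule: rtranclp_induct) (auto intro: rtranclp.rtrancl_into_rtrancl rw_atom.intros)
  finally show ?thesis .
qed

definition joinable :: "('f tm \<times> 'f tm) set \<Rightarrow> 'f tm \<Rightarrow> 'f tm \<Rightarrow> bool" where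
  "joinable E t u \<longleftrightarrow> (\<exists>v. (rw E)\<^sup>*\<^sup>* t v \<and> (rw E)\<^sup>*\<^sup>* u v)"

lemma joinable_list:
  "list_all2 (joinable E) ts us \<Longrightarrow> \<exists>vs. list_all2 (rw E)\<^sup>*\<^sup>* ts vs \<and> list_all2 (rw E)\<^sup>*\<^sup>* us vs"
proof (induction rule: list_all2_induct)
  case (Cons t ts u us)
  then obtain v vs where "(rw E)\<^sup>*\<^sup>* t v" "(rw E)\<^sup>*\<^sup>* u v"
    "list_all2 (rw E)\<^sup>*\<^sup>* ts vs" "list_all2 (rw E)\<^sup>*\<^sup>* us vs"
    by (auto simp: joinable_def)
  then show ?case by (intro exI[of _ "v # vs"]) simp
qed simp

lemma equates_joinable:
  assumes "confluentp (rw E)" and base: "\<And>t u. Eq t u \<in> H \<Longrightarrow> joinable E t u"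
  shows "equates H t u \<Longrightarrow> joinable E t u"
proof (induction rule: equates.induct)
  case (trans t u v)
  then obtain a b where a: "(rw E)\<^sup>*\<^sup>* t a" "(rw E)\<^sup>*\<^sup>* u a" and b: "(rw E)\<^sup>*\<^sup>* u b" "(rw E)\<^sup>*\<^sup>* v b"
    by (auto simp: joinable_def)
  obtain c where "(rw E)\<^sup>*\<^sup>* a c" "(rw E)\<^sup>*\<^sup>* b c"
    using confluentpD[OF assms(1) a(2) b(1)] by blast
  with a b show ?case unfolding joinable_def by (meson rtranclp_trans)
next
  case (cong ts us f)
  then have "list_all2 (joinable E) ts us" by (auto elim: list_all2_mono)
  then obtain vs where "list_all2 (rw E)\<^sup>*\<^sup>* ts vs" "list_all2 (rw E)\<^sup>*\<^sup>* us vs"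
    using joinable_list by blast
  then show ?case unfolding joinable_def by (intro exI[of _ "Fn f vs"] conjI rw_args)
next
  case (base t u)
  then show ?case by (rule assms(2))
qed (auto simp: joinable_def)


section \<open>Completing a set of equations\<close>

text \<open>
  The equations that the left replacement rule can make available.  The two equations have to be
  different because the rule needs them as separate occurrences in the antecedent.
\<close>

inductive_set completion :: "('f tm \<times> 'f tm) set \<Rightarrow> ('f tm \<times> 'f tm) set" for E where
  base: "e \<in> E \<Longrightarrow> e \<in> completion E"
| step: "(l, r) \<in> completion E \<Longrightarrow> (l', r') \<in> completion E \<Longrightarrow> (l, r) \<noteq> (l', r') \<Longrightarrow>
    rw {(l', r')} l k \<Longrightarrow> (k, r) \<in> completion E"

lemma completion_is_term:
  assumes "\<And>l r. (l, r) \<in> E \<Longrightarrow> is_term L l \<and> is_term L r"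
  shows "(l, r) \<in> completion E \<Longrightarrow> is_term L l \<and> is_term L r"
proof (induction l r rule: completion.induct[split_format (complete)])
  case (step l r l' r' k)
  then show ?case by (auto intro: rw_is_term)
qed (use assms in auto)

text \<open>
  The critical pair of \<open>l = r\<close> and an equation that rewrites \<open>l\<close> to \<open>v\<close>: the equation \<open>v = r\<close> belongs
  to the completion.
\<close>

lemma completion_overlap:
  assumes "(l, r) \<in> completion E" "rw (completion E) l v"
  shows "(rw (completion E))\<^sup>=\<^sup>= v r"
proof -
  from rw_single[OF assms(2)] obtain l' r' where e: "(l', r') \<in> completion E" "rw {(l', r')} l v"
    by blast
  show ?thesis
  proof (cases "(l, r) = (l', r')")
    case True
    then have "v = r" using rw_single_size[OF e(2)] by simp
    then show ?thesis by simp
  next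
    case False
    from completion.step[OF assms(1) e(1) this e(2)] have "(v, r) \<in> completion E" .
    then show ?thesis by (simp add: rw.root)
  qed
qed

text \<open>
  At the root a peak is a critical pair; steps in the same argument are joined by
  induction; steps in different arguments commute.
\<close>

lemma completion_subcommutative:
  "rw (completion E) t u \<Longrightarrow> rw (completion E) t v \<Longrightarrow>
    \<exists>w. (rw (completion E))\<^sup>=\<^sup>= u w \<and> (rw (completion E))\<^sup>=\<^sup>= v w"
proof (induction arbitrary: v rule: rw.induct)
  case (root l r)
  then show ?case using completion_overlap by blast
next
  case (arg i ts u f)
  let ?R = "rw (completion E)"
  from arg.prems show ?case
  proof cases
    case root
    then have "?R\<^sup>=\<^sup>= (Fn f (ts[i := u])) v"
      using completion_overlap rw.arg[OF arg.hyps(1,2)] by blast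
    then show ?thesis by blast
  next
    case (arg j u')
    show ?thesis
    proof (cases "i = j")
      case True
      then obtain w where "?R\<^sup>=\<^sup>= u w" "?R\<^sup>=\<^sup>= u' w" using arg arg.IH[of u'] by blast
      moreover have "?R\<^sup>=\<^sup>= (Fn f (ts[i := a])) (Fn f (ts[i := w]))" if "?R\<^sup>=\<^sup>= a w" for a
        using that rw.arg[of i "ts[i := a]" _ w f] \<open>i < length ts\<close> by auto
      ultimately show ?thesis using True arg by blast
    next
      case False
      have "?R (Fn f (ts[i := u])) (Fn f (ts[i := u, j := u']))"
        using rw.arg[of j "ts[i := u]" _ u' f] arg False by simp
      moreover have "?R (Fn f (ts[j := u'])) (Fn f (ts[i := u, j := u']))"
        using rw.arg[of i "ts[j := u']" _ u f] arg.hyps(1,2) \<open>i < length ts\<close> False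
        by (simp add: list_update_swap)
      ultimately show ?thesis using arg by blast
    qed
  qed
qed

lemma completion_confluent: "confluentp (rw (completion E))"
proof (rule strong_confluentp_imp_confluentp, rule strong_confluentpI)
  fix x y z assume "rw (completion E) x y" "rw (completion E) x z"
  from completion_subcommutative[OF this]
  show "\<exists>u. (rw (completion E))\<^sup>*\<^sup>* y u \<and> (rw (completion E))\<^sup>=\<^sup>= z u" by blast
qed


section \<open>The equality calculi derive all axiomatic sequents\<close>

lemma calculus_initial:
  assumes "is_sequent L (\<Gamma>, \<Delta>)" "m \<noteq> Minimal \<and> Bot \<in># \<Gamma> \<or> A \<in># \<Gamma> \<and> A \<in># \<Delta> \<and> axiom_formula m A"
  shows "derivable L (calculus_of m \<R>) (\<Gamma>, \<Delta>)"
proof -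
  have "([], (\<Gamma>, \<Delta>)) \<in> initial_sequents m"
    using assms(2)
    by (cases m)
      (auto simp: initial_def L_bot_def initial_bot_def axiom_formula_def dest!: multi_member_split)
  then show ?thesis
    using assms(1) by (rule_tac derivable.derivableI[of "[]"]) (auto simp: calculus_of_def)
qed

lemma calculus_Ref:
  assumes "is_sequent L (\<Gamma>, add_mset (Eq t t) \<Delta>)" "Ref \<in> \<R>"
  shows "derivable L (calculus_of m \<R>) (\<Gamma>, add_mset (Eq t t) \<Delta>)"
proof (rule derivable.derivableI[of "[]"])
  have "([], (\<Gamma>, add_mset (Eq t t) \<Delta>)) \<in> Ref" by (auto simp: Ref_def)
  then show "([], (\<Gamma>, add_mset (Eq t t) \<Delta>)) \<in> calculus_of m \<R>"
    using assms(2) by (auto simp: calculus_of_def)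
qed (use assms(1) in auto)

lemma calculus_Rep_right:
  assumes "Rep_right d \<in> \<R>" "oriented d l r \<in># \<Gamma>" "atomic P" "is_sequent L (\<Gamma>, add_mset (P\<langle>x/l\<rangle>) \<Delta>)"
    and "derivable L (calculus_of m \<R>) (\<Gamma>, add_mset (P\<langle>x/r\<rangle>) \<Delta>)"
  shows "derivable L (calculus_of m \<R>) (\<Gamma>, add_mset (P\<langle>x/l\<rangle>) \<Delta>)"
proof -
  obtain \<Gamma>' where \<Gamma>: "\<Gamma> = add_mset (oriented d l r) \<Gamma>'" using assms(2) by (auto dest: multi_member_split)
  have "([(\<Gamma>, add_mset (P\<langle>x/r\<rangle>) \<Delta>)], (\<Gamma>, add_mset (P\<langle>x/l\<rangle>) \<Delta>)) \<in> Rep_right d"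
    using assms(3) unfolding \<Gamma> Rep_right_def by blast
  with assms show ?thesis
    by (rule_tac derivable.derivableI[of "[(\<Gamma>, add_mset (P\<langle>x/r\<rangle>) \<Delta>)]"]) (auto simp: calculus_of_def)
qed

text \<open>
  Derivability of all extensions of the antecedent.  Derivations are built from the root upwards
  while new equations are added to the antecedent, and this notion leaves room for them without
  appealing to the admissibility of weakening.
\<close>

definition persistent ::
  "('f, 'p) language \<Rightarrow> ('f, 'p) rule \<Rightarrow> ('f, 'p) fm multiset \<Rightarrow> ('f, 'p) fm multiset \<Rightarrow> bool" where
  "persistent L C \<Gamma> \<Delta> \<longleftrightarrow>
    (\<forall>\<Gamma>'. \<Gamma> \<subseteq># \<Gamma>' \<longrightarrow> is_sequent L (\<Gamma>', \<Delta>) \<longrightarrow> derivable L C (\<Gamma>', \<Delta>))"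

definition equations :: "bool \<Rightarrow> ('f, 'p) fm multiset \<Rightarrow> ('f tm \<times> 'f tm) set" where
  "equations d \<Gamma> = {(l, r). oriented d l r \<in># \<Gamma>}"

lemma is_formula_oriented [simp]:
  "is_formula L (oriented d l r) \<longleftrightarrow> is_term L l \<and> is_term L r"
  by (auto simp: oriented_def)

lemma oriented_subst: "(oriented d t u)\<langle>x/s\<rangle> = oriented d (subst_tm t x s) (subst_tm u x s)"
  by (simp add: oriented_def)

context
  fixes L :: "('f, 'p) language" and m d \<R> \<Gamma>\<^sub>0
  fixes C :: "('f, 'p) rule" and E :: "('f tm \<times> 'f tm) set"
  assumes rules: "Ref \<in> \<R>" "Rep_right d \<in> \<R>" "Rep_left d \<in> \<R>"
    and wf: "is_sequent L (\<Gamma>\<^sub>0, {#})"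
  defines "C \<equiv> calculus_of m \<R>"
    and "E \<equiv> completion (equations d \<Gamma>\<^sub>0)"
begin

lemma E_is_term: "(l, r) \<in> E \<Longrightarrow> is_term L l \<and> is_term L r"
  unfolding E_def
proof (erule completion_is_term[rotated])
  fix l r assume "(l, r) \<in> equations d \<Gamma>\<^sub>0"
  then have "is_formula L (oriented d l r :: ('f, 'p) fm)" using wf by (auto simp: equations_def is_sequent_def)
  then show "is_term L l \<and> is_term L r" by simp
qed

text \<open>
  One completion step is one instance of the left rule, which keeps the rewritten equation.
\<close>

lemma calculus_Rep_left_equality:
  assumes "oriented d l' r' \<in># \<Gamma>" "oriented d l r \<in># \<Gamma>" "(l, r) \<noteq> (l', r')"
    and "rw {(l', r')} l k" "is_sequent L (\<Gamma>, \<Delta>)"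
    and "derivable L C (add_mset (oriented d k r) \<Gamma>, \<Delta>)"
  shows "derivable L C (\<Gamma>, \<Delta>)"
proof -
  have "oriented d l r \<noteq> (oriented d l' r' :: ('f, 'p) fm)" using assms(3) by (auto simp: oriented_def)
  then obtain \<Gamma>' where \<Gamma>: "\<Gamma> = add_mset (oriented d l' r') (add_mset (oriented d l r) \<Gamma>')"
    using assms(1,2) by (metis insert_noteq_member multi_member_split)
  have lr: "is_term L l" "is_term L r" using assms(5) by (auto simp: \<Gamma>)
  obtain c where c: "l = subst_tm c 0 l'" "k = subst_tm c 0 r'"
    using rw_context[OF assms(4) lr(1), of 0] by blast
  let ?e = "oriented d c r :: ('f, 'p) fm"
  have e: "?e\<langle>0/l'\<rangle> = oriented d l r" "?e\<langle>0/r'\<rangle> = oriented d k r"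
    using lr c by (simp_all add: oriented_subst is_term_def subst_tm_closed)
  have eq: "is_equality ?e" by (simp add: oriented_def is_equality_def)
  have "([(add_mset (oriented d l' r') (add_mset (?e\<langle>0/l'\<rangle>) (add_mset (?e\<langle>0/r'\<rangle>) \<Gamma>')), \<Delta>)],
      (add_mset (oriented d l' r') (add_mset (?e\<langle>0/l'\<rangle>) \<Gamma>'), \<Delta>)) \<in> Rep_left d"
    using eq unfolding Rep_left_def by blast
  then have "([(add_mset (oriented d k r) \<Gamma>, \<Delta>)], (\<Gamma>, \<Delta>)) \<in> C"
    using rules(3) unfolding e by (auto simp: C_def calculus_of_def \<Gamma> add_mset_commute)
  then show ?thesis using assms(5,6) by (rule_tac derivable.derivableI) auto
qed

text \<open>
  To derive a sequent it suffices to do so once an equation of the completion has been added.  The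
  induction follows the generation of that equation, making its two parents available before the
  equation itself.
\<close>

lemma equation_available:
  assumes "(l, r) \<in> E" "\<Gamma>\<^sub>0 \<subseteq># \<Gamma>" "is_sequent L (\<Gamma>, \<Delta>)"
    and "\<And>\<Gamma>'. \<Gamma> \<subseteq># \<Gamma>' \<Longrightarrow> oriented d l r \<in># \<Gamma>' \<Longrightarrow> is_sequent L (\<Gamma>', \<Delta>) \<Longrightarrow> derivable L C (\<Gamma>', \<Delta>)"
  shows "derivable L C (\<Gamma>, \<Delta>)"
  using assms unfolding E_def
proof (induction l r arbitrary: \<Gamma> rule: completion.induct[split_format (complete)])
  case (base l r)
  then show ?case by (auto simp: equations_def dest: mset_subset_eqD)
next
  case (step l r l' r' k)
  show ?case
  proof (rule step.IH(1)[OF step.prems(1,2)])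
    fix \<Gamma>1 assume 1: "\<Gamma> \<subseteq># \<Gamma>1" "oriented d l r \<in># \<Gamma>1" "is_sequent L (\<Gamma>1, \<Delta>)"
    show "derivable L C (\<Gamma>1, \<Delta>)"
    proof (rule step.IH(2)[OF _ 1(3)])
      show "\<Gamma>\<^sub>0 \<subseteq># \<Gamma>1" using step.prems(1) 1(1) by simp
      fix \<Gamma>2 assume 2: "\<Gamma>1 \<subseteq># \<Gamma>2" "oriented d l' r' \<in># \<Gamma>2" "is_sequent L (\<Gamma>2, \<Delta>)"
      have lr: "oriented d l r \<in># \<Gamma>2" using 2(1) 1(2) by (rule mset_subset_eqD)
      have "is_term L k" "is_term L r"
        using E_is_term[unfolded E_def, OF completion.step[OF step.hyps]] by auto
      moreover have "\<Gamma> \<subseteq># add_mset (oriented d k r) \<Gamma>2"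
        using subset_mset.order_trans[OF 1(1) 2(1)] subset_mset.order_trans by fastforce
      ultimately have "derivable L C (add_mset (oriented d k r) \<Gamma>2, \<Delta>)"
        using step.prems(3) 2(3) by simp
      then show "derivable L C (\<Gamma>2, \<Delta>)"
        by (rule calculus_Rep_left_equality[OF 2(2) lr step.hyps(3,4) 2(3)])
    qed
  qed
qed

lemma persistent_right:
  assumes "rw_atom E A B" "is_formula L A" "\<Gamma>\<^sub>0 \<subseteq># \<Gamma>" "persistent L C \<Gamma> (add_mset B \<Delta>)"
  shows "persistent L C \<Gamma> (add_mset A \<Delta>)"
  unfolding persistent_def
proof (intro allI impI)
  fix \<Gamma>' assume \<Gamma>': "\<Gamma> \<subseteq># \<Gamma>'" "is_sequent L (\<Gamma>', add_mset A \<Delta>)"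
  obtain P l r where P: "(l, r) \<in> E" "atomic P" "A = P\<langle>0/l\<rangle>" "B = P\<langle>0/r\<rangle>"
    using rw_atom_context[OF assms(1,2), of 0] by metis
  show "derivable L C (\<Gamma>', add_mset A \<Delta>)"
  proof (rule equation_available[OF P(1) _ \<Gamma>'(2)])
    show "\<Gamma>\<^sub>0 \<subseteq># \<Gamma>'" using assms(3) \<Gamma>'(1) by simp
    fix \<Gamma>'' assume *: "\<Gamma>' \<subseteq># \<Gamma>''" "oriented d l r \<in># \<Gamma>''" "is_sequent L (\<Gamma>'', add_mset A \<Delta>)"
    have "is_formula L B" using rw_atom_is_formula[OF assms(1) _ assms(2)] E_is_term by blast
    then have "derivable L C (\<Gamma>'', add_mset B \<Delta>)"
      using assms(4) *(1,3) \<Gamma>'(1) by (auto simp: persistent_def)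
    then show "derivable L C (\<Gamma>'', add_mset A \<Delta>)"
      using calculus_Rep_right[OF rules(2) *(2) P(2)] *(3) by (simp add: P C_def)
  qed
qed

text \<open>
  The restriction to \<open>A\<close> other than an equality reflects the two forms of the left rule: a predicate
  is replaced, an equality would be kept.
\<close>

lemma persistent_left:
  assumes "rw_atom E A B" "is_formula L A" "\<not> is_equality A" "\<Gamma>\<^sub>0 \<subseteq># \<Gamma>"
    and "persistent L C (add_mset B \<Gamma>) \<Delta>"
  shows "persistent L C (add_mset A \<Gamma>) \<Delta>"
  unfolding persistent_def
proof (intro allI impI)
  fix \<Gamma>' assume \<Gamma>': "add_mset A \<Gamma> \<subseteq># \<Gamma>'" "is_sequent L (\<Gamma>', \<Delta>)"
  obtain P l r where P: "(l, r) \<in> E" "atomic P" "\<not> is_equality P" "A = P\<langle>0/l\<rangle>" "B = P\<langle>0/r\<rangle>"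
    using rw_atom_context[OF assms(1,2), of 0] assms(3) by metis
  show "derivable L C (\<Gamma>', \<Delta>)"
  proof (rule equation_available[OF P(1) _ \<Gamma>'(2)])
    show "\<Gamma>\<^sub>0 \<subseteq># \<Gamma>'" using assms(4) \<Gamma>'(1)
      by (meson mset_subset_eq_insertD subset_mset.less_imp_le subset_mset.order_trans)
    fix \<Gamma>'' assume *: "\<Gamma>' \<subseteq># \<Gamma>''" "oriented d l r \<in># \<Gamma>''" "is_sequent L (\<Gamma>'', \<Delta>)"
    have sub: "add_mset A \<Gamma> \<subseteq># \<Gamma>''" using \<Gamma>'(1) *(1) by simp
    then have "A \<in># \<Gamma>''" by (auto dest: mset_subset_eqD)
    moreover have "A \<noteq> oriented d l r" using assms(3) by (auto simp: oriented_def is_equality_def)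
    ultimately obtain \<Gamma>3 where \<Gamma>3: "\<Gamma>'' = add_mset (oriented d l r) (add_mset A \<Gamma>3)"
      using *(2) by (metis insert_noteq_member multi_member_split)
    let ?\<Gamma> = "add_mset (oriented d l r) (add_mset B \<Gamma>3)"
    have "add_mset B \<Gamma> \<subseteq># ?\<Gamma>"
      using sub by (simp add: \<Gamma>3 add_mset_commute[of "oriented d l r"])
    moreover have "is_formula L B" using rw_atom_is_formula[OF assms(1) _ assms(2)] E_is_term by blast
    ultimately have "derivable L C (?\<Gamma>, \<Delta>)"
      using assms(5) *(3) by (simp add: persistent_def \<Gamma>3)
    moreover have "([(?\<Gamma>, \<Delta>)], (\<Gamma>'', \<Delta>)) \<in> Rep_left d"
      using P(2,3) unfolding P(4,5) \<Gamma>3 Rep_left_def by blast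
    then have "([(?\<Gamma>, \<Delta>)], (\<Gamma>'', \<Delta>)) \<in> C" using rules(3) by (auto simp: C_def calculus_of_def)
    ultimately show "derivable L C (\<Gamma>'', \<Delta>)" using *(3) by (rule_tac derivable.derivableI) auto
  qed
qed

lemma persistent_right_rtranclp:
  assumes "(rw_atom E)\<^sup>*\<^sup>* A B" "is_formula L A" "\<Gamma>\<^sub>0 \<subseteq># \<Gamma>" "persistent L C \<Gamma> (add_mset B \<Delta>)"
  shows "persistent L C \<Gamma> (add_mset A \<Delta>)"
  using assms(1,2)
proof (induction rule: converse_rtranclp_induct)
  case (step A A')
  then have "is_formula L A'" using rw_atom_is_formula E_is_term by blast
  with step assms(3) show ?case by (blast intro: persistent_right)
qed (use assms(4) in simp)

lemma persistent_left_rtranclp: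
  assumes "(rw_atom E)\<^sup>*\<^sup>* A B" "is_formula L A" "\<not> is_equality A" "\<Gamma>\<^sub>0 \<subseteq># \<Gamma>"
    and "persistent L C (add_mset B \<Gamma>) \<Delta>"
  shows "persistent L C (add_mset A \<Gamma>) \<Delta>"
  using assms(1-3)
proof (induction rule: converse_rtranclp_induct)
  case (step A A')
  then have "is_formula L A'" using rw_atom_is_formula E_is_term by blast
  moreover have "\<not> is_equality A'"
    using step.hyps(1) step.prems(2) by cases (auto simp: is_equality_def)
  ultimately show ?case using step assms(4) by (blast intro: persistent_left)
qed (use assms(5) in simp)

lemma equates_joinable_completion:
  assumes "\<And>t u. Eq t u \<in> H \<Longrightarrow> Eq t u \<in># \<Gamma>\<^sub>0" "equates H t u"
  shows "joinable E t u"
  using _ _ assms(2)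
proof (rule equates_joinable)
  show "confluentp (rw E)" unfolding E_def by (rule completion_confluent)
  fix t u assume "Eq t u \<in> H"
  then have "Eq t u \<in># \<Gamma>\<^sub>0" by (rule assms(1))
  then have "(t, u) \<in> E \<or> (u, t) \<in> E"
    unfolding E_def by (cases d) (auto simp: equations_def oriented_def intro: completion.base)
  then show "joinable E t u"
    unfolding joinable_def by (blast intro: rw.root)
qed

lemma persistentD: "persistent L C \<Gamma> \<Delta> \<Longrightarrow> is_sequent L (\<Gamma>, \<Delta>) \<Longrightarrow> derivable L C (\<Gamma>, \<Delta>)"
  by (simp add: persistent_def)

text \<open>
  Rewriting both sides to a common reduct leads to an instance of \<open>Ref\<close>.
\<close>

lemma derivable_equality:
  assumes "equates (set_mset \<Gamma>\<^sub>0) t u" "is_sequent L (\<Gamma>\<^sub>0, add_mset (Eq t u) \<Delta>)"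
  shows "derivable L C (\<Gamma>\<^sub>0, add_mset (Eq t u) \<Delta>)"
proof -
  obtain v where v: "(rw E)\<^sup>*\<^sup>* t v" "(rw E)\<^sup>*\<^sup>* u v"
    using equates_joinable_completion[OF _ assms(1)] by (auto simp: joinable_def)
  have "persistent L C \<Gamma>\<^sub>0 (add_mset (Eq v v) \<Delta>)"
    using rules(1) by (auto simp: persistent_def C_def intro: calculus_Ref)
  from persistent_right_rtranclp[OF rw_atom_Eq[OF v] _ _ this]
  have "persistent L C \<Gamma>\<^sub>0 (add_mset (Eq t u) \<Delta>)"
    using assms(2) by simp
  then show ?thesis using assms(2) by (rule persistentD)
qed

text \<open>
  The hypothesis and the conclusion are rewritten to a common reduct, which gives an initial
  sequent.  The hypothesis being consumed, \<open>\<Gamma>\<^sub>0\<close> is the antecedent without it; as it is not an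
  equality, the two antecedents have the same equations.
\<close>

lemma derivable_predicate:
  assumes "list_all2 (equates (set_mset (add_mset (Pre p us) \<Gamma>\<^sub>0))) us ts"
    and "is_sequent L (add_mset (Pre p us) \<Gamma>\<^sub>0, add_mset (Pre p ts) \<Delta>)"
  shows "derivable L C (add_mset (Pre p us) \<Gamma>\<^sub>0, add_mset (Pre p ts) \<Delta>)"
proof -
  have "list_all2 (joinable E) us ts"
    using assms(1) by (rule list_all2_mono) (erule equates_joinable_completion[rotated], simp)
  then obtain vs where us: "list_all2 (rw E)\<^sup>*\<^sup>* us vs" and ts: "list_all2 (rw E)\<^sup>*\<^sup>* ts vs"
    by (blast dest: joinable_list)
  have "persistent L C (add_mset (Pre p vs) \<Gamma>\<^sub>0) (add_mset (Pre p vs) \<Delta>)"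
    unfolding persistent_def C_def
    by (intro allI impI calculus_initial[where A = "Pre p vs"]) (auto dest: mset_subset_eqD)
  from persistent_left_rtranclp[OF rw_atom_Pre[OF us] _ _ _ this]
  have "persistent L C (add_mset (Pre p us) \<Gamma>\<^sub>0) (add_mset (Pre p vs) \<Delta>)"
    using assms(2) by (simp add: is_equality_def)
  from persistent_right_rtranclp[OF rw_atom_Pre[OF ts] _ _ this]
  have "persistent L C (add_mset (Pre p us) \<Gamma>\<^sub>0) (add_mset (Pre p ts) \<Delta>)"
    using assms(2) by simp
  then show ?thesis using assms(2) by (rule persistentD)
qed

end

lemma axiomatic_derivable_cases:
  assumes S: "is_sequent L S" "axiomatic m (signed_of S)"
    and eq: "\<And>t u \<Gamma> \<Delta>. is_sequent L (\<Gamma>, add_mset (Eq t u) \<Delta>) \<Longrightarrow> equates (set_mset \<Gamma>) t u \<Longrightarrow>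
      derivable L (calculus_of m \<R>) (\<Gamma>, add_mset (Eq t u) \<Delta>)"
    and pre: "\<And>p us ts \<Gamma> \<Delta>. is_sequent L (add_mset (Pre p us) \<Gamma>, add_mset (Pre p ts) \<Delta>) \<Longrightarrow>
      list_all2 (equates (set_mset (add_mset (Pre p us) \<Gamma>))) us ts \<Longrightarrow>
      derivable L (calculus_of m \<R>) (add_mset (Pre p us) \<Gamma>, add_mset (Pre p ts) \<Delta>)"
  shows "derivable L (calculus_of m \<R>) S"
proof -
  obtain \<Gamma> \<Delta> where [simp]: "S = (\<Gamma>, \<Delta>)" by fastforce
  have mem: "Right P \<in># signed_of (\<Gamma>, \<Delta>) \<longleftrightarrow> P \<in># \<Delta>" "Left P \<in># signed_of (\<Gamma>, \<Delta>) \<longleftrightarrow> P \<in># \<Gamma>" for P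
    by (auto simp: signed_of_def)
  from S(2) consider (bot) "m \<noteq> Minimal" "Bot \<in># \<Gamma>"
    | (follows) P where "P \<in># \<Delta>" "follows m (set_mset \<Gamma>) P"
    by (auto simp: axiomatic_def mem)
  then show ?thesis
  proof cases
    case bot
    then show ?thesis using S(1) calculus_initial[of L \<Gamma> \<Delta> m Bot \<R>] by simp
  next
    case follows
    then obtain \<Delta>' where \<Delta>: "\<Delta> = add_mset P \<Delta>'" by (auto dest: multi_member_split)
    from follows(2) show ?thesis
    proof cases
      case (Eq t u)
      then show ?thesis using S(1) eq by (simp add: \<Delta>)
    next
      case (Pre p us ts)
      then obtain \<Gamma>' where "\<Gamma> = add_mset (Pre p us) \<Gamma>'" by (auto dest: multi_member_split)
      then show ?thesis using Pre S(1) pre by (simp add: \<Delta>)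
    next
      case Bot
      then show ?thesis using S(1) calculus_initial[of L \<Gamma> \<Delta> m Bot \<R>] by (simp add: \<Delta>)
    qed
  qed
qed

lemma axiomatic_derivable_oriented:
  assumes "is_sequent L S" "axiomatic m (signed_of S)"
    and \<R>: "Ref \<in> \<R>" "Rep_right d \<in> \<R>" "Rep_left d \<in> \<R>"
  shows "derivable L (calculus_of m \<R>) S"
  using assms(1,2)
proof (rule axiomatic_derivable_cases)
  fix t u \<Gamma> \<Delta> assume "is_sequent L (\<Gamma>, add_mset (Eq t u) \<Delta>)" "equates (set_mset \<Gamma>) t u"
  then show "derivable L (calculus_of m \<R>) (\<Gamma>, add_mset (Eq t u) \<Delta>)"
    using derivable_equality[OF \<R>] is_sequent_antecedent by blast
next
  fix p us ts \<Gamma> \<Delta>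
  assume "is_sequent L (add_mset (Pre p us) \<Gamma>, add_mset (Pre p ts) \<Delta>)"
    and "list_all2 (equates (set_mset (add_mset (Pre p us) \<Gamma>))) us ts"
  then show "derivable L (calculus_of m \<R>) (add_mset (Pre p us) \<Gamma>, add_mset (Pre p ts) \<Delta>)"
    using derivable_predicate[OF \<R>, of L \<Gamma> p us ts \<Delta> m] is_sequent_antecedent[of L \<Gamma> \<Delta>] by simp
qed

text \<open>
  When the right rule is available in both orientations, rewriting is symmetric, so that congruent
  terms can be rewritten into each other and the antecedent need not change.
\<close>

lemma axiomatic_derivable_right:
  assumes "is_sequent L S" "axiomatic m (signed_of S)"
    and \<R>: "Ref \<in> \<R>" "\<And>d. Rep_right d \<in> \<R>"
  shows "derivable L (calculus_of m \<R>) S"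
proof -
  define E where "E \<Gamma> = {(l, r). \<exists>d. oriented d l r \<in># \<Gamma>}" for \<Gamma> :: "('a, 'b) fm multiset"
  let ?D = "\<lambda>\<Gamma> \<Delta>. derivable L (calculus_of m \<R>) (\<Gamma>, \<Delta>)"
  have rewrite: "?D \<Gamma> (add_mset A \<Delta>)"
    if "(rw_atom (E \<Gamma>))\<^sup>*\<^sup>* A B" "?D \<Gamma> (add_mset B \<Delta>)" "is_sequent L (\<Gamma>, add_mset A \<Delta>)" for \<Gamma> A B \<Delta>
    using that(1,3)
  proof (induction rule: converse_rtranclp_induct)
    case (step A A')
    have "is_term L r" if "(l, r) \<in> E \<Gamma>" for l r
    proof -
      from that obtain d where "oriented d l r \<in># \<Gamma>" by (auto simp: E_def)
      moreover have "\<forall>C \<in># \<Gamma>. is_formula L C" using step.prems by (auto simp: is_sequent_def)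
      ultimately have "is_formula L (oriented d l r :: ('a, 'b) fm)" by blast
      then show ?thesis by simp
    qed
    then have "is_formula L A'" using rw_atom_is_formula[OF step.hyps(1)] step.prems by simp
    then have "?D \<Gamma> (add_mset A' \<Delta>)" using step by simp
    moreover obtain P l r where "(l, r) \<in> E \<Gamma>" "atomic P" "A = P\<langle>0/l\<rangle>" "A' = P\<langle>0/r\<rangle>"
      using rw_atom_context[OF step.hyps(1), of L 0] step.prems by (metis is_sequent_simps(2))
    ultimately show ?case
      using calculus_Rep_right[OF \<R>(2)] step.prems by (auto simp: E_def)
  qed (rule that(2))
  have sym: "rw (E \<Gamma>) t u \<Longrightarrow> rw (E \<Gamma>) u t" for \<Gamma> t u
  proof (induction rule: rw.induct)
    case (root l r)
    then have "(r, l) \<in> E \<Gamma>" by (auto simp: E_def) (metis oriented_flip)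
    then show ?case by (rule rw.root)
  next
    case (arg i ts u f)
    then show ?case using rw.arg[of i "ts[i := u]" "E \<Gamma>" "ts ! i" f] by simp
  qed
  then have sym': "(rw (E \<Gamma>))\<^sup>*\<^sup>* t u \<Longrightarrow> (rw (E \<Gamma>))\<^sup>*\<^sup>* u t" for \<Gamma> t u
    by (metis sympI symp_rtranclp sympD)
  have conv: "(rw (E \<Gamma>))\<^sup>*\<^sup>* t u" if "equates (set_mset \<Gamma>) t u" for \<Gamma> t u
  proof -
    have "joinable (E \<Gamma>) t u"
      using _ _ that
    proof (rule equates_joinable)
      show "confluentp (rw (E \<Gamma>))" by (rule confluentpI) (blast intro: sym')
      fix t u assume "Eq t u \<in> set_mset \<Gamma>"
      then have "(t, u) \<in> E \<Gamma>" by (auto simp: E_def oriented_def)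
      then show "joinable (E \<Gamma>) t u" unfolding joinable_def by (blast intro: rw.root)
    qed
    then show ?thesis unfolding joinable_def by (meson sym' rtranclp_trans)
  qed
  show ?thesis
    using assms(1,2)
  proof (rule axiomatic_derivable_cases)
    fix t u \<Gamma> \<Delta> assume S: "is_sequent L (\<Gamma>, add_mset (Eq t u) \<Delta>)" and "equates (set_mset \<Gamma>) t u"
    then have "(rw_atom (E \<Gamma>))\<^sup>*\<^sup>* (Eq t u) (Eq u u)" by (intro rw_atom_Eq) (auto intro: conv)
    then show "?D \<Gamma> (add_mset (Eq t u) \<Delta>)"
      using S \<R>(1) by (rule_tac rewrite) (auto intro: calculus_Ref)
  next
    fix p us ts and \<Gamma> \<Delta> :: "('a, 'b) fm multiset"
    let ?\<Gamma> = "add_mset (Pre p us) \<Gamma>"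
    assume S: "is_sequent L (?\<Gamma>, add_mset (Pre p ts) \<Delta>)" and eq: "list_all2 (equates (set_mset ?\<Gamma>)) us ts"
    from eq have "list_all2 (equates (set_mset ?\<Gamma>)) ts us" by (rule list_all2_equates_sym)
    then have "list_all2 (rw (E ?\<Gamma>))\<^sup>*\<^sup>* ts us" by (rule list_all2_mono) (rule conv)
    moreover have "?D ?\<Gamma> (add_mset (Pre p us) \<Delta>)"
      using S by (intro calculus_initial[where A = "Pre p us"]) auto
    ultimately show "?D ?\<Gamma> (add_mset (Pre p ts) \<Delta>)"
      using rewrite[OF rw_atom_Pre] S by blast
  qed
qed


section \<open>Equivalence of the calculi and admissibility of the structural rules\<close>

lemma calculus_oriented_iff:
  "derivable L (calculus_of m (oriented_rules d)) S \<longleftrightarrow> is_sequent L S \<and> axiomatic m (signed_of S)"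
  using derivable_imp_axiomatic[of L m "oriented_rules d" S] derivable_is_sequent
    axiomatic_derivable_oriented[of L S m "oriented_rules d" d] by fastforce

lemma calculus_right_iff:
  "derivable L (calculus_of m R12r) S \<longleftrightarrow> is_sequent L S \<and> axiomatic m (signed_of S)"
proof -
  have R: "R12r = {Ref, Rep_right False, Rep_right True}"
    by (simp add: R12r_def Rep_oriented)
  have "Rep_right d \<in> R12r" for d unfolding R by (cases d) auto
  moreover have "Ref \<in> R12r" "\<Union>R12r \<subseteq> (\<Union>d. \<Union>(oriented_rules d))" unfolding R by auto
  ultimately show ?thesis
    using derivable_imp_axiomatic[of L m R12r S] derivable_is_sequent[of L "calculus_of m R12r" S]
      axiomatic_derivable_right[of L S m R12r] by blast
qed

lemma G3_oriented_iff:
  "derivable L (G3_ext L m (oriented_rules d)) S \<longleftrightarrow> is_sequent L S \<and> prov L m (signed_of S)"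
proof
  assume "derivable L (G3_ext L m (oriented_rules d)) S"
  then show "is_sequent L S \<and> prov L m (signed_of S)"
    by (simp add: derivable_is_sequent derivable_imp_prov)
next
  assume "is_sequent L S \<and> prov L m (signed_of S)"
  moreover have "derivable L (G3_ext L m (oriented_rules d)) S"
    if "is_sequent L S" "axiomatic m (signed_of S)" for S
  proof (rule derivable_mono)
    show "derivable L (calculus_of m (oriented_rules d)) S"
      using that by (simp only: calculus_oriented_iff)
    show "calculus_of m (oriented_rules d) \<subseteq> G3_ext L m (oriented_rules d)"
      by (auto simp: calculus_of_def G3_ext_def G3_def)
  qed
  moreover have "logical_rules L m \<subseteq> G3_ext L m (oriented_rules d)"
    by (auto simp: G3_ext_def G3_def)
  ultimately show "derivable L (G3_ext L m (oriented_rules d)) S"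
    using prov_imp_derivable by blast
qed

lemma oriented_rule_sets:
  "R2rl_plus = oriented_rules True" "R1rl_plus = oriented_rules False"
  by (simp_all add: R2rl_plus_def R1rl_plus_def Rep_oriented)

theorem theorem17:
  fixes L :: "('f, 'p) language" and m :: logic
  shows "equivalent L (calculus_of m R12r) (calculus_of m R2rl_plus)
       \<and> (\<forall>R \<in> structural_rules. admissible L (G3_ext L m R2rl_plus) R)
       \<and> equivalent L (calculus_of m R12r) (calculus_of m R1rl_plus)
       \<and> (\<forall>R \<in> structural_rules. admissible L (G3_ext L m R1rl_plus) R)"
  using calculus_right_iff[of L m] calculus_oriented_iff[of L m]
    structural_rules_admissible[OF G3_oriented_iff, of _ L m]
  unfolding equivalent_def oriented_rule_sets by blast

end
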